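(* Let $N,K,T,M\ge 1$ and $S\ge 0$ be integers with $T+K\le N$ and $\binom{N-S}{K}>\binom{N}{K}-\binom{N-T}{K}$. Then, for every sufficiently large prime power $q$ and every generator matrix $\mathbf{G}\in\mathbb{F}_q^{K\times N}$ of an $(N,K)$-MDS code, there exist a positive integer $L$ and an $(N,K,T;M)$-PIR scheme with $S$ robust servers, for $M$ files in $\mathbb{F}_q^{L\times K}$ stored via $\mathbf{G}$, whose rate is $$\frac{\binom{N-S-1}{K-1}}{\binom{N-1}{K-1}}\left(1+R+R^2+\cdots+R^{M-1}\right)^{-1},\qquad\text{where } R=\frac{\binom{N}{K}-\binom{N-T}{K}}{\binom{N-S}{K}}.$$
   Context: Storage. There are $N$ servers and $M$ files $W^{[1]},\dots,W^{[M]}\in\mathbb{F}_q^{L\times K}$, independent and uniformly distributed (entropies are in $q$-ary units, so $H(W^{[i]})=LK$ and $H(W^{[1]},\dots,W^{[M]})=MLK$). Let $\mathbf{G}=[\mathbf{g}_1\ \cdots\ \mathbf{g}_N]\in\mathbb{F}_q^{K\times N}$ have the MDS property: any $K$ columns are linearly independent. Server $n$ stores $\mathbf{y}_n=(W^{[1]}\mathbf{g}_n,\dots,W^{[M]}\mathbf{g}_n)\in\mathbb{F}_q^{ML}$. PIR scheme with $S$ robust servers. The user wants file $W^{[i]}$. There is a random variable $\mathcal{F}$ (the user's randomness for generating queries, unknown to the servers) and a random variable $\mathcal{G}$ (the servers' randomness for producing feedbacks, also known to the user; it may be deterministic); $\mathcal{F},\mathcal{G},i,W^{[1]},\dots,W^{[M]}$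 are mutually independent. Using $\mathcal F$, the user generates queries $Q^{[i]}_1,\dots,Q^{[i]}_N$, with $Q^{[i]}_n$ sent to server $n$, such that $I(Q^{[i]}_1,\dots,Q^{[i]}_N;W^{[1]},\dots,W^{[M]})=0$. The feedback $A^{[i]}_n$ of server $n$ is a deterministic function of $Q^{[i]}_n,\mathcal{G},\mathbf{y}_n$. Some $S$ of the $N$ servers, not known in advance to the user and called robust servers, fail to respond. The requirements are: - Correctness: for every $\mathcal{J}=\{j_1,\dots,j_{N-S}\}\subseteq\{1,\dots,N\}$ of size $N-S$ (the responding servers), $H(W^{[i]}\mid Q^{[i]}_1,\dots,Q^{[i]}_N,A^{[i]}_{j_1},\dots,A^{[i]}_{j_{N-S}},\mathcal{F},\mathcal{G})=0$. - Privacy: for every $\mathcal{T}\subseteq\{1,\dots,N\}$ with $|\mathcal{T}|=T$ (possibly containing robust servers), $I(i;Q^{[i]}_{\mathcal{T}})=I(i;A^{[i]}_{\mathcal{T}})=0$, where $Q^{[i]}_{\mathcal{T}}=\{Q^{[i]}_n:n\in\mathcal{T}\}$ and $A^{[i]}_{\mathcal{T}}=\{A^{[i]}_n:n\in\mathcal{T}\}$. Rate: $H(W^{[i]})/\sum_{n\in\mathcal{J}}H(A^{[i]}_n)$, where $\mathcal{J}$ is the set of $N-S$ responding servers (servers that fail to respond produce no download cost); the scheme has the stated rate for every such $\mathcal{J}$. *)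

theory Defs
  imports
    "HOL-Probability.Probability"
    "HOL-Algebra.Ring"
    "HOL-Number_Theory.Prime_Powers"
begin

text \<open>
  Servers are indexed by \<open>{..<N}\<close>, files by \<open>{..<M}\<close>, rows of a file by \<open>{..<L}\<close> and its columns
  by \<open>{..<K}\<close>.  The finite field is a ring record \<open>R\<close> rather than a type, because the size of the
  field has to be quantified inside a formula.  Every finite field is isomorphic to one whose carrier
  consists of natural numbers, so ranging over \<open>R :: nat ring\<close> covers all of them.  Likewise, finite
  sets of random values, queries or answers can always be written as sets of strings, of type
  \<open>nat list\<close>.
\<close>

definition mds_generator ::
  "('c, 'z) ring_scheme \<Rightarrow> nat \<Rightarrow> nat \<Rightarrow> (nat \<Rightarrow> nat \<Rightarrow> 'c) \<Rightarrow> bool" where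
  "mds_generator R K N G \<longleftrightarrow>
     (\<forall>k<K. \<forall>n<N. G k n \<in> carrier R) \<and>
     (\<forall>J \<subseteq> {..<N}. card J = K \<longrightarrow>
        (\<forall>c \<in> J \<rightarrow> carrier R.
           (\<forall>k<K. (\<Oplus>\<^bsub>R\<^esub>n\<in>J. c n \<otimes>\<^bsub>R\<^esub> G k n) = \<zero>\<^bsub>R\<^esub>) \<longrightarrow> (\<forall>n\<in>J. c n = \<zero>\<^bsub>R\<^esub>)))"

type_synonym 'c file_matrix = "nat \<times> nat \<Rightarrow> 'c"

definition file_tuples ::
  "('c, 'z) ring_scheme \<Rightarrow> nat \<Rightarrow> nat \<Rightarrow> nat \<Rightarrow> (nat \<Rightarrow> 'c file_matrix) set" where
  "file_tuples R M L K = {..<M} \<rightarrow>\<^sub>E ({..<L} \<times> {..<K} \<rightarrow>\<^sub>E carrier R)"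

text \<open>
  Entry \<open>(i, l)\<close> of the content of server \<open>n\<close> is the \<open>l\<close>-th coordinate of \<open>W i\<close> times the
  \<open>n\<close>-th column of \<open>G\<close>.
\<close>

definition stored ::
  "('c, 'z) ring_scheme \<Rightarrow> nat \<Rightarrow> nat \<Rightarrow> nat \<Rightarrow> (nat \<Rightarrow> nat \<Rightarrow> 'c) \<Rightarrow>
   (nat \<Rightarrow> 'c file_matrix) \<Rightarrow> nat \<Rightarrow> (nat \<times> nat \<Rightarrow> 'c)" where
  "stored R M L K G W n =
     (\<lambda>(i, l) \<in> {..<M} \<times> {..<L}. \<Oplus>\<^bsub>R\<^esub>k\<in>{..<K}. W i (l, k) \<otimes>\<^bsub>R\<^esub> G k n)"

definition finite_prob_space :: "'a measure \<Rightarrow> bool" where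
  "finite_prob_space P \<longleftrightarrow> prob_space P \<and> finite (space P) \<and> sets P = Pow (space P)"

text \<open>
  \<open>query Sch i f n\<close> is the query to server \<open>n\<close> when file \<open>i\<close> is wanted and the user's randomness
  takes the value \<open>f\<close>.  In \<open>answer Sch n x g y\<close> the arguments are the server, the query it receives,
  the value of the servers' randomness and the stored content; in particular an answer depends on
  the desired index only through the query.
\<close>

record ('c, 'f, 'g, 'x, 'a) scheme =
  user_rand :: "'f measure"
  server_rand :: "'g measure"
  query :: "nat \<Rightarrow> 'f \<Rightarrow> nat \<Rightarrow> 'x"
  answer :: "nat \<Rightarrow> 'x \<Rightarrow> 'g \<Rightarrow> (nat \<times> nat \<Rightarrow> 'c) \<Rightarrow> 'a"

text \<open>
  An outcome is a triple of file contents, user randomness and servers' randomness.  The product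
  measure makes these three independent, and the files independent and uniform.
\<close>

definition pir_space ::
  "('c, 'z) ring_scheme \<Rightarrow> nat \<Rightarrow> nat \<Rightarrow> nat \<Rightarrow> ('c, 'f, 'g, 'x, 'a) scheme \<Rightarrow>
   ((nat \<Rightarrow> 'c file_matrix) \<times> 'f \<times> 'g) measure" where
  "pir_space R M L K Sch =
     uniform_count_measure (file_tuples R M L K) \<Otimes>\<^sub>M (user_rand Sch \<Otimes>\<^sub>M server_rand Sch)"

definition rv_file :: "nat \<Rightarrow> (nat \<Rightarrow> 'c file_matrix) \<times> 'f \<times> 'g \<Rightarrow> 'c file_matrix" where
  "rv_file i = (\<lambda>(W, f, g). W i)"

definition rv_query ::
  "('c, 'f, 'g, 'x, 'a) scheme \<Rightarrow> nat \<Rightarrow> nat \<Rightarrow> (nat \<Rightarrow> 'c file_matrix) \<times> 'f \<times> 'g \<Rightarrow> 'x" where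
  "rv_query Sch i n = (\<lambda>(W, f, g). query Sch i f n)"

definition rv_answer ::
  "('c, 'z) ring_scheme \<Rightarrow> nat \<Rightarrow> nat \<Rightarrow> nat \<Rightarrow> (nat \<Rightarrow> nat \<Rightarrow> 'c) \<Rightarrow>
   ('c, 'f, 'g, 'x, 'a) scheme \<Rightarrow> nat \<Rightarrow> nat \<Rightarrow> (nat \<Rightarrow> 'c file_matrix) \<times> 'f \<times> 'g \<Rightarrow> 'a" where
  "rv_answer R M L K G Sch i n =
     (\<lambda>(W, f, g). answer Sch n (query Sch i f n) g (stored R M L K G W n))"

definition family :: "nat set \<Rightarrow> (nat \<Rightarrow> 'w \<Rightarrow> 'a) \<Rightarrow> 'w \<Rightarrow> (nat \<Rightarrow> 'a)" where
  "family T X = (\<lambda>\<omega>. \<lambda>n\<in>T. X n \<omega>)"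

text \<open>
  The library's information measures for discrete random variables; their usual notation is only
  available inside the locale \<open>information_space\<close>, where the space and the base are fixed.
\<close>

abbreviation ent :: "real \<Rightarrow> 'w measure \<Rightarrow> ('w \<Rightarrow> 'a) \<Rightarrow> real" where
  "ent b P X \<equiv> prob_space.entropy P b (count_space (X ` space P)) X"

abbreviation cond_ent :: "real \<Rightarrow> 'w measure \<Rightarrow> ('w \<Rightarrow> 'a) \<Rightarrow> ('w \<Rightarrow> 'b) \<Rightarrow> real" where
  "cond_ent b P X Y \<equiv>
     prob_space.conditional_entropy P b (count_space (X ` space P)) (count_space (Y ` space P)) X Y"

abbreviation mutual_info :: "real \<Rightarrow> 'w measure \<Rightarrow> ('w \<Rightarrow> 'a) \<Rightarrow> ('w \<Rightarrow> 'b) \<Rightarrow> real" where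
  "mutual_info b P X Y \<equiv>
     prob_space.mutual_information P b (count_space (X ` space P)) (count_space (Y ` space P)) X Y"

definition queries_independent_of_files ::
  "('c, 'z) ring_scheme \<Rightarrow> nat \<Rightarrow> nat \<Rightarrow> nat \<Rightarrow> nat \<Rightarrow> ('c, 'f, 'g, 'x, 'a) scheme \<Rightarrow> bool" where
  "queries_independent_of_files R N M L K Sch \<longleftrightarrow>
     (\<forall>i<M. mutual_info (real (card (carrier R))) (pir_space R M L K Sch)
              (family {..<N} (rv_query Sch i)) (family {..<M} rv_file) = 0)"

definition pir_correct ::
  "('c, 'z) ring_scheme \<Rightarrow> nat \<Rightarrow> nat \<Rightarrow> nat \<Rightarrow> nat \<Rightarrow> nat \<Rightarrow> (nat \<Rightarrow> nat \<Rightarrow> 'c) \<Rightarrow>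
   ('c, 'f, 'g, 'x, 'a) scheme \<Rightarrow> bool" where
  "pir_correct R N S M L K G Sch \<longleftrightarrow>
     (\<forall>i<M. \<forall>J \<subseteq> {..<N}. card J = N - S \<longrightarrow>
        cond_ent (real (card (carrier R))) (pir_space R M L K Sch)
          (rv_file i)
          (\<lambda>\<omega>. (family {..<N} (rv_query Sch i) \<omega>,
                family J (rv_answer R M L K G Sch i) \<omega>,
                fst (snd \<omega>), snd (snd \<omega>))) = 0)"

text \<open>
  For privacy the desired index is itself random, independent of everything else.  Its distribution
  is left arbitrary, so privacy is demanded for every prior \<open>\<Theta>\<close> on the set of indices.
\<close>

definition pir_private ::
  "('c, 'z) ring_scheme \<Rightarrow> nat \<Rightarrow> nat \<Rightarrow> nat \<Rightarrow> nat \<Rightarrow> nat \<Rightarrow> (nat \<Rightarrow> nat \<Rightarrow> 'c) \<Rightarrow>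
   ('c, 'f, 'g, 'x, 'a) scheme \<Rightarrow> bool" where
  "pir_private R N T M L K G Sch \<longleftrightarrow>
     (\<forall>\<Theta> :: nat measure. finite_prob_space \<Theta> \<and> space \<Theta> = {..<M} \<longrightarrow>
       (\<forall>A \<subseteq> {..<N}. card A = T \<longrightarrow>
          mutual_info (real (card (carrier R))) (\<Theta> \<Otimes>\<^sub>M pir_space R M L K Sch)
            fst (\<lambda>(i, \<omega>). family A (rv_query Sch i) \<omega>) = 0 \<and>
          mutual_info (real (card (carrier R))) (\<Theta> \<Otimes>\<^sub>M pir_space R M L K Sch)
            fst (\<lambda>(i, \<omega>). family A (rv_answer R M L K G Sch i) \<omega>) = 0))"

text \<open>An \<open>(N, K, T; M)\<close>-PIR scheme with \<open>S\<close> robust (non-responding) servers.\<close>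

definition pir_scheme ::
  "('c, 'z) ring_scheme \<Rightarrow> nat \<Rightarrow> nat \<Rightarrow> nat \<Rightarrow> nat \<Rightarrow> nat \<Rightarrow> nat \<Rightarrow> (nat \<Rightarrow> nat \<Rightarrow> 'c) \<Rightarrow>
   ('c, 'f, 'g, 'x, 'a) scheme \<Rightarrow> bool" where
  "pir_scheme R N K T S M L G Sch \<longleftrightarrow>
     finite_prob_space (user_rand Sch) \<and> finite_prob_space (server_rand Sch) \<and>
     queries_independent_of_files R N M L K Sch \<and>
     pir_correct R N S M L K G Sch \<and>
     pir_private R N T M L K G Sch"

definition pir_rate ::
  "('c, 'z) ring_scheme \<Rightarrow> nat \<Rightarrow> nat \<Rightarrow> nat \<Rightarrow> (nat \<Rightarrow> nat \<Rightarrow> 'c) \<Rightarrow>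
   ('c, 'f, 'g, 'x, 'a) scheme \<Rightarrow> nat \<Rightarrow> nat set \<Rightarrow> real" where
  "pir_rate R M L K G Sch i J =
     ent (real (card (carrier R))) (pir_space R M L K Sch) (rv_file i) /
     (\<Sum>n\<in>J. ent (real (card (carrier R))) (pir_space R M L K Sch) (rv_answer R M L K G Sch i n))"

end

(*
The server contents enter a query through uniformly random linear bijections of the column space, one
per file, so that a set of query vectors is hidden as soon as they are linearly independent.
Queries come in groups indexed by words of length M over an alphabet of size D = (N - S choose K);
each group has one query per K-set of servers, and a K-set of responding servers recovers its sum in
full.  With al = (N choose K) - (N - T choose K), the number of K-sets that meet T given servers, a
group w asks for sums over the files l with al <= w l.  The wanted file is protected within each
group by an MDS code of dimension D, hence is decoded from the D surviving K-sets; the interference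
of the D groups that agree off position i lies in an MDS code of dimension al * D, hence is
determined by the al groups that do not involve file i, and is unconstrained on the positions that
T servers can see.  Whatever i is, T servers therefore see the images under the random bijections
of equally many linearly independent vectors.
*)
theory Submission
  imports Defs "HOL-Algebra.Multiplicative_Group"
begin

section \<open>Finite probability spaces\<close>

text \<open>The dimension \<open>\<alpha> * D\<close> of the interference code is forced from two
  sides. In the \<open>D\<close> groups that agree off letter i, T servers see
  \<open>\<alpha>\<close> symbols per group, so at least \<open>\<alpha> * D\<close> dimensions are
  needed for these to be independent; the \<open>\<alpha>\<close> groups without file i yield
  \<open>D\<close> surviving symbols each, so no more than \<open>\<alpha> * D\<close> dimensions
  can be decoded. Indexing by words offers such a bundle of \<open>D\<close> groups for every
  position i at once. A file is active in \<open>(D - \<alpha>) * D ^ (M - 1)\<close> words, and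
  \<open>D ^ M - \<alpha> ^ M\<close> words have an active file; the quotient of the two counts is
  the geometric sum in \<open>\<alpha> / D\<close>. The obstacle is that privacy and rate are
  statements about entropies, whereas no law of a tuple of random vectors is ever computed. For
  privacy, the symbols visible to T servers are completed to a square bijective linear map, which
  the random bijection absorbs: changing the wanted index then merely permutes the keys. For the
  rate, additivity and surjectivity of an answer make all its fibres equally large.\<close>

lemma finite_prob_space_uniform:
  assumes "finite A" "A \<noteq> {}"
  shows "finite_prob_space (uniform_count_measure A)"
  using assms prob_space_uniform_count_measure
  by (auto simp: finite_prob_space_def space_uniform_count_measure sets_uniform_count_measure)

lemma sets_pair_Pow:
  assumes "finite A" "finite B" "sets P = Pow A" "sets Q = Pow B"
  shows "sets (P \<Otimes>\<^sub>M Q) = Pow (A \<times> B)"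
proof -
  have "sets (P \<Otimes>\<^sub>M Q) = sets (count_space A \<Otimes>\<^sub>M count_space B)"
    by (rule sets_pair_measure_cong) (simp_all add: assms)
  also have "\<dots> = Pow (A \<times> B)"
    unfolding pair_measure_count_space[OF assms(1,2)] by simp
  finally show ?thesis .
qed

lemma finite_prob_space_pair:
  assumes "finite_prob_space P" "finite_prob_space Q"
  shows "finite_prob_space (P \<Otimes>\<^sub>M Q)"
proof -
  have "prob_space (P \<Otimes>\<^sub>M Q)"
    using assms by (intro prob_space_pair) (simp_all add: finite_prob_space_def)
  thus ?thesis
    using assms sets_pair_Pow[of "space P" "space Q" P Q]
    by (auto simp: finite_prob_space_def space_pair_measure)
qed

text \<open>Turns the whole sample space into one uniform space, so that probabilities become
  cardinalities.\<close>

lemma uniform_count_measure_pair: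
  assumes "finite A" "finite B" "A \<noteq> {}" "B \<noteq> {}"
  shows "uniform_count_measure A \<Otimes>\<^sub>M uniform_count_measure B = uniform_count_measure (A \<times> B)"
proof (rule measure_eqI_finite)
  interpret B: prob_space "uniform_count_measure B"
    using assms by (intro prob_space_uniform_count_measure)
  show "sets (uniform_count_measure A \<Otimes>\<^sub>M uniform_count_measure B) = Pow (A \<times> B)"
    using assms by (intro sets_pair_Pow) (simp_all add: sets_uniform_count_measure)
  fix z assume z: "z \<in> A \<times> B"
  then obtain x y where xy: "z = (x, y)" "x \<in> A" "y \<in> B" by auto
  have "emeasure (uniform_count_measure A \<Otimes>\<^sub>M uniform_count_measure B) ({x} \<times> {y}) =
    emeasure (uniform_count_measure A) {x} * emeasure (uniform_count_measure B) {y}"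
    using xy by (intro B.emeasure_pair_measure_Times) (auto simp: sets_uniform_count_measure)
  also have "\<dots> = emeasure (uniform_count_measure (A \<times> B)) {z}"
    using assms xy by (simp add: emeasure_uniform_count_measure card_cartesian_product
        ennreal_mult'[symmetric] divide_simps)
  finally show "emeasure (uniform_count_measure A \<Otimes>\<^sub>M uniform_count_measure B) {z} =
      emeasure (uniform_count_measure (A \<times> B)) {z}"
    using xy by simp
qed (use assms in \<open>auto simp: sets_uniform_count_measure\<close>)

lemma finite_prob_space_simple:
  assumes "finite_prob_space P"
  shows "simple_function P X"
  using assms by (auto simp: simple_function_def finite_prob_space_def)

lemma finite_prob_space_measurable:
  assumes "finite_prob_space P" "X ` space P \<subseteq> space Q"
  shows "X \<in> measurable P Q"
  using assms by (auto simp: measurable_def finite_prob_space_def)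

lemma finite_prob_space_information:
  assumes "finite_prob_space P" "1 < b"
  shows "information_space P b"
  using assms by (simp add: information_space_def information_space_axioms_def finite_prob_space_def)

text \<open>Under independence the joint law and the product of the marginals agree on singletons,
  hence everywhere, and the divergence of a measure from itself vanishes.\<close>

lemma mutual_info_indep:
  assumes P: "finite_prob_space P" and b: "1 < b"
    and ind: "\<And>A B. measure P {\<omega>\<in>space P. X \<omega> \<in> A \<and> Y \<omega> \<in> B} =
       measure P {\<omega>\<in>space P. X \<omega> \<in> A} * measure P {\<omega>\<in>space P. Y \<omega> \<in> B}"
  shows "mutual_info b P X Y = 0"
proof -
  interpret information_space P b
    using finite_prob_space_information[OF P b] .
  let ?S = "count_space (X ` space P)" and ?T = "count_space (Y ` space P)"
  have rv: "random_variable ?S X" "random_variable ?T Y"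
    using P by (auto intro: finite_prob_space_measurable)
  have fin: "finite (X ` space P)" "finite (Y ` space P)"
    using P by (auto simp: finite_prob_space_def)
  interpret X: prob_space "distr P ?S X" by (rule prob_space_distr) fact
  interpret Y: prob_space "distr P ?T Y" by (rule prob_space_distr) fact
  have eq: "distr P ?S X \<Otimes>\<^sub>M distr P ?T Y = distr P (?S \<Otimes>\<^sub>M ?T) (\<lambda>x. (X x, Y x))"
  proof (rule measure_eqI_finite)
    fix z assume "z \<in> X ` space P \<times> Y ` space P"
    then obtain x y where z: "z = (x, y)" "x \<in> X ` space P" "y \<in> Y ` space P" by auto
    have XY: "(\<lambda>x. (X x, Y x)) \<in> measurable P (?S \<Otimes>\<^sub>M ?T)"
      using rv by simp
    have *: "{z} \<in> sets (?S \<Otimes>\<^sub>M ?T)"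
      using z fin by (subst sets_pair_Pow[of "X ` space P" "Y ` space P"]) auto
    have "emeasure (distr P ?S X \<Otimes>\<^sub>M distr P ?T Y) ({x} \<times> {y}) =
      emeasure (distr P ?S X) {x} * emeasure (distr P ?T Y) {y}"
      using z by (intro Y.emeasure_pair_measure_Times) auto
    also have "\<dots> = emeasure P (X -` {x} \<inter> space P) * emeasure P (Y -` {y} \<inter> space P)"
      using z rv by (simp add: emeasure_distr)
    also have "\<dots> = ennreal (prob {\<omega>\<in>space P. X \<omega> \<in> {x}} * prob {\<omega>\<in>space P. Y \<omega> \<in> {y}})"
      by (simp add: emeasure_eq_measure ennreal_mult vimage_def Int_def conj_commute)
    also have "\<dots> = ennreal (prob {\<omega>\<in>space P. X \<omega> \<in> {x} \<and> Y \<omega> \<in> {y}})"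
      by (simp only: ind)
    also have "\<dots> = emeasure (distr P (?S \<Otimes>\<^sub>M ?T) (\<lambda>x. (X x, Y x))) {z}"
      by (subst emeasure_distr[OF XY *])
       (auto simp: z(1) emeasure_eq_measure intro!: arg_cong[where f = prob])
    finally show "emeasure (distr P ?S X \<Otimes>\<^sub>M distr P ?T Y) {z} =
        emeasure (distr P (?S \<Otimes>\<^sub>M ?T) (\<lambda>x. (X x, Y x))) {z}"
      using z by simp
  qed (use fin in \<open>simp_all add: sets_pair_Pow[of "X ` space P" "Y ` space P"]\<close>)
  interpret XY: pair_prob_space "distr P ?S X" "distr P ?T Y" ..
  show ?thesis
    unfolding mutual_information_def eq[symmetric] by (rule XY.KL_same_eq_0)
qed

text \<open>A conditional law that is the same for every value of the first coordinate means
  independence of that coordinate. Privacy has the index as the first argument, query independence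
  has the files as the second, hence both orders.\<close>

lemma mutual_info_pair_eq_0:
  assumes Q: "finite_prob_space Q" and P: "finite_prob_space P" and b: "1 < b"
    and c: "\<And>i B. i \<in> space Q \<Longrightarrow> measure P {\<omega>\<in>space P. Y (i, \<omega>) \<in> B} = p B"
  shows "mutual_info b (Q \<Otimes>\<^sub>M P) (\<lambda>z. X (fst z)) Y = 0"
    and "mutual_info b (Q \<Otimes>\<^sub>M P) Y (\<lambda>z. X (fst z)) = 0"
proof -
  interpret Q1: prob_space Q using Q by (simp add: finite_prob_space_def)
  interpret P1: prob_space P using P by (simp add: finite_prob_space_def)
  have fp: "finite_prob_space (Q \<Otimes>\<^sub>M P)"
    using finite_prob_space_pair[OF Q P] .
  interpret prob_space "Q \<Otimes>\<^sub>M P" using fp by (simp add: finite_prob_space_def)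
  have sets: "sets (Q \<Otimes>\<^sub>M P) = Pow (space Q \<times> space P)" "sets Q = Pow (space Q)"
    using fp Q by (auto simp: finite_prob_space_def space_pair_measure)
  obtain i0 where i0: "i0 \<in> space Q" using Q1.not_empty by auto
  have p0: "0 \<le> p B" for B using c[OF i0, of B] measure_nonneg[of P] by metis
  have *: "prob {z\<in>space (Q \<Otimes>\<^sub>M P). X (fst z) \<in> A \<and> Y z \<in> B} =
    measure Q {i\<in>space Q. X i \<in> A} * p B" for A B
  proof -
    let ?E = "{z\<in>space (Q \<Otimes>\<^sub>M P). X (fst z) \<in> A \<and> Y z \<in> B}"
    \<comment> \<open>Integration over the first coordinate: a slice is empty or an event of
      probability \<open>p B\<close>.\<close>
    have "emeasure (Q \<Otimes>\<^sub>M P) ?E = (\<integral>\<^sup>+i. emeasure P (Pair i -` ?E) \<partial>Q)"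
      by (rule P1.emeasure_pair_measure_alt) (auto simp: sets space_pair_measure)
    also have "\<dots> = (\<integral>\<^sup>+i. ennreal (p B) * indicator {i\<in>space Q. X i \<in> A} i \<partial>Q)"
    proof (rule nn_integral_cong)
      fix i assume i: "i \<in> space Q"
      have "Pair i -` ?E = (if X i \<in> A then {\<omega>\<in>space P. Y (i, \<omega>) \<in> B} else {})"
        using i by (auto simp: space_pair_measure)
      thus "emeasure P (Pair i -` ?E) = ennreal (p B) * indicator {i\<in>space Q. X i \<in> A} i"
        using i c[OF i] by (auto simp: P1.emeasure_eq_measure indicator_def)
    qed
    also have "\<dots> = ennreal (p B) * emeasure Q {i\<in>space Q. X i \<in> A}"
      by (subst nn_integral_cmult_indicator) (auto simp: sets)
    also have "\<dots> = ennreal (measure Q {i\<in>space Q. X i \<in> A} * p B)"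
      using p0 by (simp add: Q1.emeasure_eq_measure ennreal_mult mult.commute)
    finally show ?thesis
      using p0 by (simp add: emeasure_eq_measure)
  qed
  have X: "prob {z\<in>space (Q \<Otimes>\<^sub>M P). X (fst z) \<in> A} = measure Q {i\<in>space Q. X i \<in> A}" for A
    using *[of A UNIV] c[OF i0, of UNIV] P1.prob_space by simp
  have Y: "prob {z\<in>space (Q \<Otimes>\<^sub>M P). Y z \<in> B} = p B" for B
    using *[of UNIV B] Q1.prob_space by simp
  show "mutual_info b (Q \<Otimes>\<^sub>M P) (\<lambda>z. X (fst z)) Y = 0"
    by (rule mutual_info_indep[OF fp b]) (simp only: X Y *)
  show "mutual_info b (Q \<Otimes>\<^sub>M P) Y (\<lambda>z. X (fst z)) = 0"
    by (rule mutual_info_indep[OF fp b]) (subst conj_commute, simp only: X Y * mult.commute)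
qed

text \<open>When \<open>Y\<close> determines \<open>X\<close>, the pair is an injective image of
  \<open>Y\<close> and has the same entropy; the chain rule then leaves nothing for \<open>X\<close>
  given \<open>Y\<close>.\<close>

lemma cond_ent_eq_0:
  assumes P: "finite_prob_space P" and b: "1 < b"
    and det: "\<And>\<omega> \<omega>'. \<omega> \<in> space P \<Longrightarrow> \<omega>' \<in> space P \<Longrightarrow> Y \<omega> = Y \<omega>' \<Longrightarrow> X \<omega> = X \<omega>'"
  shows "cond_ent b P X Y = 0"
proof -
  interpret information_space P b
    using finite_prob_space_information[OF P b] .
  note simp = finite_prob_space_simple[OF P]
  define h where "h y = X (SOME \<omega>. \<omega> \<in> space P \<and> Y \<omega> = y)" for y
  have h: "h (Y \<omega>) = X \<omega>" if "\<omega> \<in> space P" for \<omega>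
  proof -
    have "\<exists>\<omega>'. \<omega>' \<in> space P \<and> Y \<omega>' = Y \<omega>" using that by blast
    from someI_ex[OF this] show ?thesis
      unfolding h_def using that det by blast
  qed
  let ?f = "\<lambda>y. (y, h y)"
  have "entropy_Pow (\<lambda>x. (Y x, X x)) = entropy_Pow (?f \<circ> Y)"
  proof -
    have im: "(\<lambda>x. (Y x, X x)) ` space P = (?f \<circ> Y) ` space P"
      using h by (auto simp: image_iff)
    have "distr P S (\<lambda>x. (Y x, X x)) = distr P S (?f \<circ> Y)" for S :: "('b \<times> 'c) measure"
      by (rule distr_cong) (simp_all add: h)
    hence "entropy b (count_space ((?f \<circ> Y) ` space P)) (\<lambda>x. (Y x, X x)) =
        entropy b (count_space ((?f \<circ> Y) ` space P)) (?f \<circ> Y)"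
      by (simp only: entropy_def)
    thus ?thesis
      by (simp only: im)
  qed
  also have "\<dots> = entropy_Pow (Y)"
    by (rule entropy_of_inj[OF simp]) (auto simp: inj_on_def)
  finally show ?thesis
    using entropy_chain_rule[OF simp simp, of Y X] by simp
qed

text \<open>The inequality between fibre sizes is assumed for all ordered pairs, so the fibres are
  equally large and \<open>X\<close> is uniform on its image.\<close>

lemma ent_uniform:
  assumes A: "finite A" "A \<noteq> {}" and b: "1 < b"
    and fib: "\<And>x y. x \<in> X ` A \<Longrightarrow> y \<in> X ` A \<Longrightarrow> card {\<omega>\<in>A. X \<omega> = x} \<le> card {\<omega>\<in>A. X \<omega> = y}"
  shows "ent b (uniform_count_measure A) X = log b (real (card (X ` A)))"
proof -
  let ?P = "uniform_count_measure A"
  have P: "finite_prob_space ?P" using finite_prob_space_uniform[OF A] .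
  interpret information_space ?P b
    using finite_prob_space_information[OF P b] .
  have sp: "space ?P = A" by (rule space_uniform_count_measure)
  have fX: "finite (X ` A)" and X0: "card (X ` A) > 0" using A by (auto simp: card_gt_0_iff)
  obtain x0 where x0: "x0 \<in> X ` A" using A by auto
  define m where "m = card {\<omega>\<in>A. X \<omega> = x0}"
  have m: "card {\<omega>\<in>A. X \<omega> = x} = m" if "x \<in> X ` A" for x
    using fib[OF that x0] fib[OF x0 that] by (simp add: m_def)
  have "card A = (\<Sum>x\<in>X ` A. card {\<omega>\<in>A. X \<omega> = x})"
    using sum.image_gen[OF A(1), of "\<lambda>_. 1::nat" X] by simp
  hence cA: "card A = card (X ` A) * m" using m by simp
  have m0: "m > 0" using cA A by (metis card_gt_0_iff mult_0_right neq0_conv)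
  have pr: "prob (X -` {x} \<inter> space ?P) = 1 / card (X ` A)" if "x \<in> X ` A" for x
  proof -
    have "X -` {x} \<inter> space ?P = {\<omega>\<in>A. X \<omega> = x}" by (auto simp: sp)
    thus ?thesis using m[OF that] cA m0 A
      by (simp add: measure_uniform_count_measure)
  qed
  have "entropy b (count_space (X ` A)) X = - (\<Sum>x\<in>X ` A. prob (X -` {x} \<inter> space ?P) * log b (prob (X -` {x} \<inter> space ?P)))"
    using entropy_simple_distributed[OF simple_distributedI[OF finite_prob_space_simple[OF P] measure_nonneg refl, of X]]
    by (simp only: sp)
  also have "\<dots> = log b (real (card (X ` A)))"
    using pr X0 b by (simp add: log_divide)
  finally show ?thesis by (simp only: sp)
qed

lemma ex_inj_nat_list:
  assumes "finite A"
  shows "\<exists>e :: 'a \<Rightarrow> nat list. inj_on e A"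
proof -
  obtain f :: "'a \<Rightarrow> nat" where "inj_on f A"
    using assms finite_imp_inj_to_nat_seg by blast
  hence "inj_on (\<lambda>x. [f x]) A" by (auto simp: inj_on_def)
  thus ?thesis by blast
qed

section \<open>From answer maps to schemes\<close>

text \<open>The device behind privacy: a relabelling of the outcomes does not change the uniform
  measure, so it may depend on the wanted index.\<close>

lemma measure_uniform_bij:
  assumes A: "finite A" and h: "bij_betw h A A" and eq: "\<And>\<omega>. \<omega> \<in> A \<Longrightarrow> Y \<omega> = Z (h \<omega>)"
  shows "measure (uniform_count_measure A) {\<omega>\<in>A. Y \<omega> \<in> B} =
    measure (uniform_count_measure A) {\<omega>\<in>A. Z \<omega> \<in> B}"
proof -
  have "bij_betw h {\<omega>\<in>A. Y \<omega> \<in> B} {\<omega>\<in>A. Z \<omega> \<in> B}"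
    using h unfolding bij_betw_def
    by (auto simp: eq inj_on_def) (metis (no_types, lifting) eq image_iff mem_Collect_eq)
  hence "card {\<omega>\<in>A. Y \<omega> \<in> B} = card {\<omega>\<in>A. Z \<omega> \<in> B}"
    by (rule bij_betw_same_card)
  thus ?thesis
    using A by (simp add: measure_uniform_count_measure)
qed

text \<open>A query is the answer map itself: the table assigning to every possible content of the server
  the answer to be returned, encoded injectively as a string.\<close>

lemma scheme_of_answer_maps:
  fixes R :: "nat ring" and G :: "nat \<Rightarrow> nat \<Rightarrow> nat" and N M L K S T m :: nat
    and ans :: "nat \<Rightarrow> 'f \<Rightarrow> nat \<Rightarrow> (nat \<times> nat \<Rightarrow> nat) \<Rightarrow> 'a"
    and Tgt :: "nat \<Rightarrow> 'a set"
  defines "files \<equiv> file_tuples R M L K" and "q \<equiv> card (carrier R)"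
  assumes F: "finite F" "F \<noteq> {}" and R: "finite (carrier R)" "q \<ge> 2"
    and correct: "\<And>i J f W W'. i < M \<Longrightarrow> J \<subseteq> {..<N} \<Longrightarrow> card J = N - S \<Longrightarrow> f \<in> F \<Longrightarrow>
      W \<in> files \<Longrightarrow> W' \<in> files \<Longrightarrow>
      (\<And>n. n \<in> J \<Longrightarrow> ans i f n (stored R M L K G W n) = ans i f n (stored R M L K G W' n)) \<Longrightarrow>
      W i = W' i"
    and privacy: "\<And>A. A \<subseteq> {..<N} \<Longrightarrow> card A = T \<Longrightarrow> \<exists>can \<phi>. \<forall>i<M. bij_betw (\<phi> i) F F \<and>
      (\<forall>f\<in>F. \<forall>n\<in>A. \<forall>W\<in>files.
         ans i f n (stored R M L K G W n) = can (\<phi> i f) n (stored R M L K G W n))"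
    and target: "\<And>n. n < N \<Longrightarrow> finite (Tgt n)" "\<And>n. n < N \<Longrightarrow> card (Tgt n) = q ^ m"
      "\<And>i f n W. i < M \<Longrightarrow> f \<in> F \<Longrightarrow> n < N \<Longrightarrow> W \<in> files \<Longrightarrow> ans i f n (stored R M L K G W n) \<in> Tgt n"
    and fibres: "\<And>i f n a a'. i < M \<Longrightarrow> f \<in> F \<Longrightarrow> n < N \<Longrightarrow> a \<in> Tgt n \<Longrightarrow> a' \<in> Tgt n \<Longrightarrow>
      card {W\<in>files. ans i f n (stored R M L K G W n) = a} \<le>
      card {W\<in>files. ans i f n (stored R M L K G W n) = a'}"
  shows "\<exists>Sch :: (nat, nat list, nat list, nat list, nat list) scheme.
    pir_scheme R N K T S M L G Sch \<and>
    (\<forall>i<M. \<forall>J \<subseteq> {..<N}. card J = N - S \<longrightarrow>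
       pir_rate R M L K G Sch i J = real (L * K) / real ((N - S) * m))"
proof -
  let ?st = "stored R M L K G"
  define Y where "Y n = (\<lambda>W. ?st W n) ` files" for n
  have ff: "finite files"
    unfolding files_def file_tuples_def using R by (intro finite_PiE) auto
  have fne: "files \<noteq> {}"
    unfolding files_def file_tuples_def using R by (auto simp: PiE_eq_empty_iff q_def)
  have "finite (\<Union>n<N. Tgt n)" using target by auto
  then obtain encA :: "'a \<Rightarrow> nat list" where encA: "inj_on encA (\<Union>n<N. Tgt n)"
    using ex_inj_nat_list by blast
  \<comment> \<open>The table is restricted to contents that can occur. Two queries then coincide as
    soon as the answers agree on stored contents, which is all that \<open>privacy\<close>
    provides.\<close>
  define tab where "tab an f n = (\<lambda>y\<in>Y n. encA (an f n y))" for an and f :: 'f and n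
  define QF where "QF = (\<lambda>(i, f, n). tab (ans i) f n) ` ({..<M} \<times> F \<times> {..<N})"
  have "finite QF" using F by (simp add: QF_def)
  then obtain encQ :: "((nat \<times> nat \<Rightarrow> nat) \<Rightarrow> nat list) \<Rightarrow> nat list" where encQ: "inj_on encQ QF"
    using ex_inj_nat_list by blast
  obtain encF :: "'f \<Rightarrow> nat list" where encF: "inj_on encF F"
    using ex_inj_nat_list[OF F(1)] by blast
  define decF where "decF = inv_into F encF"
  define F' where "F' = encF ` F"
  have F': "finite F'" "F' \<noteq> {}" using F by (auto simp: F'_def)
  have decF: "decF f \<in> F" "encF (decF f) = f" if "f \<in> F'" for f
    using that by (auto simp: F'_def decF_def inv_into_into f_inv_into_f)
  have decF': "decF (encF f) = f" if "f \<in> F" for f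
    using that encF by (simp add: decF_def)
  \<comment> \<open>Feedbacks are deterministic, so the servers' randomness is a point mass. A
    server decodes its query to a table and looks up its content.\<close>
  define Sch :: "(nat, nat list, nat list, nat list, nat list) scheme" where
    "Sch = \<lparr>user_rand = uniform_count_measure F', server_rand = uniform_count_measure {[]},
      query = (\<lambda>i f n. encQ (tab (ans i) (decF f) n)),
      answer = (\<lambda>n x g y. inv_into QF encQ x y)\<rparr>"
  define \<Omega> where "\<Omega> = files \<times> F' \<times> {[] :: nat list}"
  have \<Omega>: "finite \<Omega>" "\<Omega> \<noteq> {}" using ff fne F' by (auto simp: \<Omega>_def)
  have sp: "pir_space R M L K Sch = uniform_count_measure \<Omega>"
    unfolding pir_space_def Sch_def \<Omega>_def using ff fne F' files_def
    by (simp add: uniform_count_measure_pair)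
  have space: "space (uniform_count_measure \<Omega>) = \<Omega>" by (rule space_uniform_count_measure)
  have fpU: "finite_prob_space (uniform_count_measure \<Omega>)" using \<Omega> by (rule finite_prob_space_uniform)
  have b: "1 < real q" using R by simp
  have answer: "rv_answer R M L K G Sch i n (W, f, g) = encA (ans i (decF f) n (?st W n))"
    if "i < M" "n < N" "W \<in> files" "f \<in> F'" for i n W f g
  proof -
    have "tab (ans i) (decF f) n \<in> QF"
      unfolding QF_def using that decF by (intro image_eqI[of _ _ "(i, decF f, n)"]) auto
    thus ?thesis
      using that encQ by (simp add: rv_answer_def Sch_def tab_def Y_def)
  qed
  have "queries_independent_of_files R N M L K Sch"
    unfolding queries_independent_of_files_def
  proof (intro allI impI)
    fix i assume "i < M"
    let ?Q = "user_rand Sch \<Otimes>\<^sub>M server_rand Sch"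
    have fam: "family {..<M} rv_file = (\<lambda>z :: (nat \<Rightarrow> nat file_matrix) \<times> nat list \<times> nat list.
        restrict (fst z) {..<M})"
      by (auto simp: family_def rv_file_def fun_eq_iff)
    show "mutual_info (real (card (carrier R))) (pir_space R M L K Sch)
              (family {..<N} (rv_query Sch i)) (family {..<M} rv_file) = 0"
      unfolding pir_space_def fam
    proof (rule mutual_info_pair_eq_0(2)[where X = "\<lambda>W. restrict W {..<M}"
          and p = "\<lambda>B. measure ?Q {\<omega>\<in>space ?Q. (\<lambda>n\<in>{..<N}. query Sch i (fst \<omega>) n) \<in> B}"])
      show "finite_prob_space (uniform_count_measure (file_tuples R M L K))"
        using ff fne by (intro finite_prob_space_uniform) (auto simp: files_def)
      show "finite_prob_space ?Q"
        using F' by (intro finite_prob_space_pair) (simp_all add: Sch_def finite_prob_space_uniform)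
      show "measure ?Q {\<omega>\<in>space ?Q. family {..<N} (rv_query Sch i) (W, \<omega>) \<in> B} =
        measure ?Q {\<omega>\<in>space ?Q. (\<lambda>n\<in>{..<N}. query Sch i (fst \<omega>) n) \<in> B}" for W B
        by (auto simp: family_def rv_query_def intro!: arg_cong[where f = "measure ?Q"])
    qed (use b q_def in simp)
  qed
  moreover have "pir_correct R N S M L K G Sch"
    unfolding pir_correct_def sp
  proof (intro allI impI cond_ent_eq_0 fpU)
    fix i J \<omega> \<omega>'
    assume i: "i < M" and J: "J \<subseteq> {..<N}" "card J = N - S"
      and "\<omega> \<in> space (uniform_count_measure \<Omega>)" "\<omega>' \<in> space (uniform_count_measure \<Omega>)"
      and eq: "(family {..<N} (rv_query Sch i) \<omega>, family J (rv_answer R M L K G Sch i) \<omega>,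
         fst (snd \<omega>), snd (snd \<omega>)) =
        (family {..<N} (rv_query Sch i) \<omega>', family J (rv_answer R M L K G Sch i) \<omega>',
         fst (snd \<omega>'), snd (snd \<omega>'))"
    then obtain W f W' where w: "\<omega> = (W, f, [])" "\<omega>' = (W', f, [])" "W \<in> files" "W' \<in> files" "f \<in> F'"
      unfolding space unfolding \<Omega>_def by auto
    have "ans i (decF f) n (?st W n) = ans i (decF f) n (?st W' n)" if n: "n \<in> J" for n
    proof -
      have nN: "n < N" using n J by auto
      have "rv_answer R M L K G Sch i n \<omega> = rv_answer R M L K G Sch i n \<omega>'"
        using eq n by (auto simp: family_def dest!: fun_cong[of _ _ n])
      hence "encA (ans i (decF f) n (?st W n)) = encA (ans i (decF f) n (?st W' n))"
        using w i nN by (simp add: answer)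
      thus ?thesis
        using target(3)[OF i decF(1)[OF w(5)] nN] w(3,4) nN
        by (intro inj_onD[OF encA]) auto
    qed
    from correct[OF i J decF(1)[OF w(5)] w(3,4) this] show "rv_file i \<omega> = rv_file i \<omega>'"
      using w by (simp add: rv_file_def)
  qed (use b q_def in simp)
  moreover have "pir_private R N T M L K G Sch"
    unfolding pir_private_def
  proof (intro allI impI)
    fix \<Theta> :: "nat measure" and A
    assume \<Theta>: "finite_prob_space \<Theta> \<and> space \<Theta> = {..<M}" and A: "A \<subseteq> {..<N}" "card A = T"
    obtain can \<phi> where \<phi>: "\<And>i. i < M \<Longrightarrow> bij_betw (\<phi> i) F F"
      and can: "\<And>i f n W. i < M \<Longrightarrow> f \<in> F \<Longrightarrow> n \<in> A \<Longrightarrow> W \<in> files \<Longrightarrow>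
         ans i f n (?st W n) = can (\<phi> i f) n (?st W n)"
      using privacy[OF A] by blast
    \<comment> \<open>\<open>h i\<close> replaces the user's randomness by its image under
      \<open>\<phi> i\<close> and keeps the files. Queries and answers of \<open>A\<close> become
      \<open>Zq\<close> and \<open>Za\<close> after \<open>h i\<close>, and neither of these two
      functions mentions \<open>i\<close>.\<close>
    define h where "h i = (\<lambda>(W :: nat \<Rightarrow> nat file_matrix, f, g :: nat list). (W, encF (\<phi> i (decF f)), g))" for i
    have h: "bij_betw (h i) \<Omega> \<Omega>" if i: "i < M" for i
    proof -
      have \<phi>': "\<phi> i f \<in> F" if "f \<in> F" for f using \<phi>[OF i] that by (auto simp: bij_betw_def)
      have "inj_on (h i) \<Omega>"
      proof (rule inj_onI)
        fix x y assume xy: "x \<in> \<Omega>" "y \<in> \<Omega>" "h i x = h i y"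
        obtain W f g W' f' g' where [simp]: "x = (W, f, g)" "y = (W', f', g')" by (metis prod_cases3)
        have f: "f \<in> F'" "f' \<in> F'" using xy by (auto simp: \<Omega>_def)
        have "encF (\<phi> i (decF f)) = encF (\<phi> i (decF f'))" and r: "W = W'" "g = g'"
          using xy by (auto simp: h_def)
        hence "\<phi> i (decF f) = \<phi> i (decF f')"
          using \<phi>' decF f encF by (meson inj_onD)
        hence "decF f = decF f'" using \<phi>[OF i] decF f by (meson bij_betw_def inj_onD)
        thus "x = y" using r decF(2) f by (metis \<open>x = _\<close> \<open>y = _\<close>)
      qed
      moreover have "h i ` \<Omega> \<subseteq> \<Omega>"
        using \<phi>' decF by (auto simp: h_def \<Omega>_def F'_def)
      ultimately show ?thesis
        using endo_inj_surj[OF \<Omega>(1), of "h i"] by (simp add: bij_betw_def)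
    qed
    define Zq where "Zq = (\<lambda>(W :: nat \<Rightarrow> nat file_matrix, f, g :: nat list). \<lambda>n\<in>A. encQ (tab can (decF f) n))"
    define Za where "Za = (\<lambda>(W, f, g :: nat list). \<lambda>n\<in>A. encA (can (decF f) n (?st W n)))"
    have tabeq: "tab (ans i) f n = tab can (\<phi> i f) n" if "i < M" "f \<in> F" "n \<in> A" for i f n
      using can[OF that] by (auto simp: tab_def Y_def fun_eq_iff restrict_def)
    have \<phi>dec: "decF (encF (\<phi> i (decF f))) = \<phi> i (decF f)" if "i < M" "f \<in> F'" for i f
      using \<phi>[OF that(1)] decF[OF that(2)] by (intro decF') (auto simp: bij_betw_def)
    have q: "family A (rv_query Sch i) \<omega> = Zq (h i \<omega>)" if "i < M" "\<omega> \<in> \<Omega>" for i \<omega>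
      using that decF A
      by (auto simp: family_def rv_query_def Zq_def h_def \<Omega>_def Sch_def \<phi>dec tabeq intro!: restrict_ext)
    have a: "family A (rv_answer R M L K G Sch i) \<omega> = Za (h i \<omega>)" if iM: "i < M" and \<omega>: "\<omega> \<in> \<Omega>" for i \<omega>
    proof -
      obtain W f g where w: "\<omega> = (W, f, g)" "W \<in> files" "f \<in> F'"
        using \<omega> by (auto simp: \<Omega>_def)
      show ?thesis
        unfolding family_def w(1) Za_def h_def prod.case
      proof (rule restrict_ext)
        fix n assume n: "n \<in> A"
        show "rv_answer R M L K G Sch i n (W, f, g) = encA (can (decF (encF (\<phi> i (decF f)))) n (?st W n))"
          using n A w iM decF by (subst answer) (auto simp: \<phi>dec can)
      qed
    qed
    have "finite_prob_space \<Theta>" and i: "\<And>i. i \<in> space \<Theta> \<Longrightarrow> i < M" using \<Theta> by auto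
    note * = mutual_info_pair_eq_0(1)[OF this(1) fpU, of "real q" _ _ "\<lambda>x. x", OF b]
    show "mutual_info (real (card (carrier R))) (\<Theta> \<Otimes>\<^sub>M pir_space R M L K Sch)
            fst (\<lambda>(i, \<omega>). family A (rv_query Sch i) \<omega>) = 0 \<and>
          mutual_info (real (card (carrier R))) (\<Theta> \<Otimes>\<^sub>M pir_space R M L K Sch)
            fst (\<lambda>(i, \<omega>). family A (rv_answer R M L K G Sch i) \<omega>) = 0"
      unfolding sp q_def[symmetric]
      by (intro conjI; rule *; unfold space prod.case;
          rule measure_uniform_bij[OF \<Omega>(1) h]; erule i q[OF i] a[OF i])
  qed
  moreover have "finite_prob_space (user_rand Sch)" "finite_prob_space (server_rand Sch)"
    using F' by (simp_all add: Sch_def finite_prob_space_uniform)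
  ultimately have "pir_scheme R N K T S M L G Sch"
    by (simp add: pir_scheme_def)
  moreover have "pir_rate R M L K G Sch i J = real (L * K) / real ((N - S) * m)"
    if i: "i < M" and J: "J \<subseteq> {..<N}" "card J = N - S" for i J
  proof -
    have upd: "W(i := w) \<in> files" if "W \<in> files" "w \<in> ({..<L} \<times> {..<K} \<rightarrow>\<^sub>E carrier R)" for W w
      using that i unfolding files_def file_tuples_def by (auto simp: PiE_iff extensional_def)
    have img: "rv_file i ` \<Omega> = ({..<L} \<times> {..<K} \<rightarrow>\<^sub>E carrier R)"
    proof
      show "rv_file i ` \<Omega> \<subseteq> ({..<L} \<times> {..<K} \<rightarrow>\<^sub>E carrier R)"
      proof (rule image_subsetI)
        fix \<omega> assume "\<omega> \<in> \<Omega>"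
        hence "fst \<omega> \<in> files" by (auto simp: \<Omega>_def)
        thus "rv_file i \<omega> \<in> ({..<L} \<times> {..<K} \<rightarrow>\<^sub>E carrier R)"
          using i PiE_mem[of "fst \<omega>" "{..<M}" _ i]
          by (simp add: rv_file_def files_def file_tuples_def case_prod_beta)
      qed
      obtain W f where Wf: "W \<in> files" "f \<in> F'" using fne F' by auto
      show "({..<L} \<times> {..<K} \<rightarrow>\<^sub>E carrier R) \<subseteq> rv_file i ` \<Omega>"
      proof
        fix w assume "w \<in> ({..<L} \<times> {..<K} \<rightarrow>\<^sub>E carrier R)"
        hence "W(i := w) \<in> files" by (rule upd[OF Wf(1)])
        thus "w \<in> rv_file i ` \<Omega>"
          using Wf unfolding \<Omega>_def
          by (intro image_eqI[of _ _ "(W(i := w), f, [])"]) (auto simp: rv_file_def)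
      qed
    qed
    have "ent (real q) (uniform_count_measure \<Omega>) (rv_file i) = log (real q) (real (card (rv_file i ` \<Omega>)))"
    proof (rule ent_uniform[OF \<Omega> b])
      fix x y assume x: "x \<in> rv_file i ` \<Omega>" and y: "y \<in> rv_file i ` \<Omega>"
      show "card {\<omega> \<in> \<Omega>. rv_file i \<omega> = x} \<le> card {\<omega> \<in> \<Omega>. rv_file i \<omega> = y}"
      \<comment> \<open>Overwriting file \<open>i\<close> by \<open>y\<close> embeds the outcomes
        with value \<open>x\<close> into those with value \<open>y\<close>.\<close>
      proof (rule card_inj_on_le)
        have "W = W'" if "W(i := y) = W'(i := y)" "W i = W' i" for W W' :: "nat \<Rightarrow> nat file_matrix"
          using that by (metis fun_upd_triv fun_upd_upd)
        thus "inj_on (\<lambda>(W, f, g). (W(i := y), f, g)) {\<omega> \<in> \<Omega>. rv_file i \<omega> = x}"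
          by (auto simp: inj_on_def rv_file_def)
        show "(\<lambda>(W, f, g). (W(i := y), f, g)) ` {\<omega> \<in> \<Omega>. rv_file i \<omega> = x} \<subseteq> {\<omega> \<in> \<Omega>. rv_file i \<omega> = y}"
          using upd y unfolding img by (auto simp: \<Omega>_def rv_file_def)
      qed (use \<Omega> in auto)
    qed
    also have "card (rv_file i ` \<Omega>) = q ^ (L * K)"
      unfolding img by (simp add: card_PiE q_def)
    finally have 1: "ent (real q) (uniform_count_measure \<Omega>) (rv_file i) = real (L * K)"
      using b by (simp add: log_nat_power)
    have 2: "ent (real q) (uniform_count_measure \<Omega>) (rv_answer R M L K G Sch i n) = real m" if n: "n < N" for n
    proof -
      let ?A = "rv_answer R M L K G Sch i n"
      \<comment> \<open>The fibre of an answer splits over the user's randomness;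
        \<open>fibres\<close> compares the pieces and summation over \<open>F'\<close> gives
        \<open>le\<close>.\<close>
      define fib where "fib a f = {W\<in>files. ans i f n (?st W n) = a}" for a f
      have set: "{\<omega> \<in> \<Omega>. ?A \<omega> = encA a} = (\<lambda>(f, W). (W, f, [])) ` (SIGMA f:F'. fib a (decF f))"
        if a: "a \<in> Tgt n" for a
      proof -
        have "encA (ans i (decF f) n (?st W n)) = encA a \<longleftrightarrow> ans i (decF f) n (?st W n) = a"
          if "f \<in> F'" "W \<in> files" for f W
          using a n target(3)[OF i decF(1)[OF that(1)] n that(2)] by (auto dest: inj_onD[OF encA])
        thus ?thesis
          using i n by (auto simp: \<Omega>_def fib_def answer image_iff)
      qed
      have cd: "card {\<omega> \<in> \<Omega>. ?A \<omega> = encA a} = (\<Sum>f\<in>F'. card (fib a (decF f)))" if a: "a \<in> Tgt n" for a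
      proof -
        have "inj_on (\<lambda>(f, W). (W, f, [])) (SIGMA f:F'. fib a (decF f))" by (auto simp: inj_on_def)
        thus ?thesis
          using F' ff unfolding set[OF a] by (subst card_image) (auto simp: card_SigmaI fib_def)
      qed
      have le: "card {\<omega> \<in> \<Omega>. ?A \<omega> = encA a} \<le> card {\<omega> \<in> \<Omega>. ?A \<omega> = encA a'}"
        if "a \<in> Tgt n" "a' \<in> Tgt n" for a a'
        unfolding cd[OF that(1)] cd[OF that(2)] fib_def
        using fibres[OF i decF(1) n that] by (intro sum_mono) auto
      have sub: "?A ` \<Omega> \<subseteq> encA ` Tgt n"
        using target(3)[OF i decF(1) n] i n by (auto simp: \<Omega>_def answer)
      \<comment> \<open>All of \<open>Tgt n\<close> is attained: some fibre is non-empty, and by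
        \<open>le\<close> no fibre is smaller than it.\<close>
      have img: "?A ` \<Omega> = encA ` Tgt n"
      proof (intro equalityI sub image_subsetI)
        fix a assume a: "a \<in> Tgt n"
        obtain \<omega> where w: "\<omega> \<in> \<Omega>" using \<Omega> by auto
        then obtain a0 where a0: "a0 \<in> Tgt n" "?A \<omega> = encA a0" using sub by blast
        hence "\<omega> \<in> {\<omega> \<in> \<Omega>. ?A \<omega> = encA a0}" using w by simp
        moreover have "finite {\<omega> \<in> \<Omega>. ?A \<omega> = encA a0}" using \<Omega>(1) by simp
        ultimately have "0 < card {\<omega> \<in> \<Omega>. ?A \<omega> = encA a0}"
          unfolding card_gt_0_iff by blast
        hence "0 < card {\<omega> \<in> \<Omega>. ?A \<omega> = encA a}" using le[OF a0(1) a] by simp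
        hence "{\<omega> \<in> \<Omega>. ?A \<omega> = encA a} \<noteq> {}" unfolding card_gt_0_iff by simp
        then obtain \<omega>' where "\<omega>' \<in> \<Omega>" "?A \<omega>' = encA a" by blast
        thus "encA a \<in> ?A ` \<Omega>" by (intro image_eqI[of _ _ \<omega>']) simp_all
      qed
      have "ent (real q) (uniform_count_measure \<Omega>) ?A = log (real q) (real (card (?A ` \<Omega>)))"
        by (rule ent_uniform[OF \<Omega> b]) (use le in \<open>auto simp: img\<close>)
      also have "card (?A ` \<Omega>) = q ^ m"
        unfolding img using target(2)[OF n] n by (subst card_image) (auto intro: inj_on_subset[OF encA])
      finally show ?thesis
        using b by (simp add: log_nat_power)
    qed
    have "(\<Sum>n\<in>J. ent (real q) (uniform_count_measure \<Omega>) (rv_answer R M L K G Sch i n)) = (\<Sum>n\<in>J. real m)"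
      using J by (intro sum.cong refl 2) auto
    thus ?thesis
      unfolding pir_rate_def sp q_def[symmetric] 1 using J by simp
  qed
  ultimately show ?thesis by blast
qed

section \<open>Vectors and MDS matrices over a finite field\<close>

text \<open>Extensional functions, so that there are finitely many vectors and agreement on
  \<open>X\<close> is equality.\<close>

definition vecs :: "('c, 'z) ring_scheme \<Rightarrow> 'x set \<Rightarrow> ('x \<Rightarrow> 'c) set" where
  "vecs R X = (X \<rightarrow>\<^sub>E carrier R)"

text \<open>The single condition on u + a v covers additivity and homogeneity.\<close>

definition lin_map :: "('c, 'z) ring_scheme \<Rightarrow> 'x set \<Rightarrow> 'y set \<Rightarrow> (('x \<Rightarrow> 'c) \<Rightarrow> 'y \<Rightarrow> 'c) \<Rightarrow> bool" where
  "lin_map R X Y \<phi> \<longleftrightarrow> \<phi> \<in> vecs R X \<rightarrow> vecs R Y \<and>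
     (\<forall>u\<in>vecs R X. \<forall>v\<in>vecs R X. \<forall>a\<in>carrier R.
        \<phi> (\<lambda>x\<in>X. u x \<oplus>\<^bsub>R\<^esub> a \<otimes>\<^bsub>R\<^esub> v x) = (\<lambda>y\<in>Y. \<phi> u y \<oplus>\<^bsub>R\<^esub> a \<otimes>\<^bsub>R\<^esub> \<phi> v y))"

text \<open>Rows are code positions, columns are message symbols. The MDS property is put as unique
  decoding from any \<open>card E\<close> positions, the form needed both for decoding and for the
  bijectivity behind privacy.\<close>

definition mds_matrix :: "('c, 'z) ring_scheme \<Rightarrow> 'p set \<Rightarrow> 'e set \<Rightarrow> ('p \<Rightarrow> 'e \<Rightarrow> 'c) \<Rightarrow> bool" where
  "mds_matrix R P E V \<longleftrightarrow> (\<forall>p\<in>P. \<forall>e\<in>E. V p e \<in> carrier R) \<and>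
     (\<forall>Q\<subseteq>P. card Q = card E \<longrightarrow> (\<forall>t\<in>E \<rightarrow> carrier R. \<forall>t'\<in>E \<rightarrow> carrier R.
        (\<forall>p\<in>Q. (\<Oplus>\<^bsub>R\<^esub>e\<in>E. V p e \<otimes>\<^bsub>R\<^esub> t e) = (\<Oplus>\<^bsub>R\<^esub>e\<in>E. V p e \<otimes>\<^bsub>R\<^esub> t' e)) \<longrightarrow>
        (\<forall>e\<in>E. t e = t' e)))"

lemma mds_matrixD:
  assumes "mds_matrix R P E V" "Q \<subseteq> P" "card Q = card E"
    and "\<And>e. e \<in> E \<Longrightarrow> t e \<in> carrier R" "\<And>e. e \<in> E \<Longrightarrow> t' e \<in> carrier R"
    and "\<And>p. p \<in> Q \<Longrightarrow> (\<Oplus>\<^bsub>R\<^esub>e\<in>E. V p e \<otimes>\<^bsub>R\<^esub> t e) = (\<Oplus>\<^bsub>R\<^esub>e\<in>E. V p e \<otimes>\<^bsub>R\<^esub> t' e)"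
    and "e \<in> E"
  shows "t e = t' e"
proof -
  have "t \<in> E \<rightarrow> carrier R" "t' \<in> E \<rightarrow> carrier R" using assms(4,5) by blast+
  with assms(1-3,6,7) show ?thesis unfolding mds_matrix_def by blast
qed

lemma finite_vecs: "finite X \<Longrightarrow> finite (carrier R) \<Longrightarrow> finite (vecs R X)"
  by (simp add: vecs_def finite_PiE)

lemma card_vecs: "finite X \<Longrightarrow> card (vecs R X) = card (carrier R) ^ card X"
  by (simp add: vecs_def card_PiE)

lemma vecs_mem: "v \<in> vecs R X \<Longrightarrow> x \<in> X \<Longrightarrow> v x \<in> carrier R"
  by (auto simp: vecs_def)

lemma vecs_restrict: "(\<And>x. x \<in> X \<Longrightarrow> f x \<in> carrier R) \<Longrightarrow> (\<lambda>x\<in>X. f x) \<in> vecs R X"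
  by (auto simp: vecs_def)

lemma vecs_eqI: "u \<in> vecs R X \<Longrightarrow> v \<in> vecs R X \<Longrightarrow> (\<And>x. x \<in> X \<Longrightarrow> u x = v x) \<Longrightarrow> u = v"
  unfolding vecs_def by (rule PiE_ext)

lemma lin_map_vecs: "lin_map R X Y \<phi> \<Longrightarrow> u \<in> vecs R X \<Longrightarrow> \<phi> u \<in> vecs R Y"
  by (auto simp: lin_map_def)

lemma lin_mapD:
  assumes "lin_map R X Y \<phi>" "u \<in> vecs R X" "v \<in> vecs R X" "a \<in> carrier R" "y \<in> Y"
  shows "\<phi> (\<lambda>x\<in>X. u x \<oplus>\<^bsub>R\<^esub> a \<otimes>\<^bsub>R\<^esub> v x) y = \<phi> u y \<oplus>\<^bsub>R\<^esub> a \<otimes>\<^bsub>R\<^esub> \<phi> v y"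
  using assms by (simp add: lin_map_def)

lemma (in ring) lin_map_compose:
  assumes "lin_map R X Y \<phi>" "lin_map R Y Z \<psi>"
  shows "lin_map R X Z (compose (vecs R X) \<psi> \<phi>)"
  unfolding lin_map_def
proof (intro conjI ballI)
  show "compose (vecs R X) \<psi> \<phi> \<in> vecs R X \<rightarrow> vecs R Z"
    using assms by (auto simp: compose_def lin_map_vecs)
  fix u v a assume u: "u \<in> vecs R X" "v \<in> vecs R X" "a \<in> carrier R"
  have "(\<lambda>x\<in>X. u x \<oplus> a \<otimes> v x) \<in> vecs R X"
    using u by (intro vecs_restrict) (auto dest: vecs_mem)
  thus "compose (vecs R X) \<psi> \<phi> (\<lambda>x\<in>X. u x \<oplus> a \<otimes> v x) =
    (\<lambda>y\<in>Z. compose (vecs R X) \<psi> \<phi> u y \<oplus> a \<otimes> compose (vecs R X) \<psi> \<phi> v y)"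
    using assms u by (simp add: compose_def lin_map_def Pi_def)
qed

lemma (in ring) lin_map_add:
  assumes "lin_map R X Y \<phi>" "u \<in> vecs R X" "v \<in> vecs R X" "y \<in> Y"
  shows "\<phi> (\<lambda>x\<in>X. u x \<oplus> v x) y = \<phi> u y \<oplus> \<phi> v y"
proof -
  have "(\<lambda>x\<in>X. u x \<oplus> v x) = (\<lambda>x\<in>X. u x \<oplus> \<one> \<otimes> v x)"
    using assms by (intro restrict_ext) (simp add: vecs_mem)
  thus ?thesis
    using assms lin_map_vecs[OF assms(1,3)] by (simp add: lin_map_def vecs_mem)
qed

lemma (in ring) lin_map_zero:
  assumes "lin_map R X Y \<phi>" "y \<in> Y"
  shows "\<phi> (\<lambda>x\<in>X. \<zero>) y = \<zero>"
proof -
  let ?z = "\<lambda>x\<in>X. \<zero>"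
  have z: "?z \<in> vecs R X" by (rule vecs_restrict) simp
  have "(\<lambda>x\<in>X. ?z x \<oplus> ?z x) = ?z" by (rule restrict_ext) simp
  hence "\<phi> ?z y = \<phi> ?z y \<oplus> \<phi> ?z y"
    using lin_map_add[OF assms(1) z z assms(2)] by (simp only:)
  thus ?thesis
    using vecs_mem[OF lin_map_vecs[OF assms(1) z] assms(2)] by (metis add.l_cancel_one)
qed

lemma (in ring) lin_map_sum:
  assumes \<phi>: "lin_map R X Y \<phi>" and y: "y \<in> Y" and "finite I"
    and "\<And>i. i \<in> I \<Longrightarrow> v i \<in> vecs R X" "\<And>i. i \<in> I \<Longrightarrow> c i \<in> carrier R"
  shows "\<phi> (\<lambda>x\<in>X. \<Oplus>i\<in>I. c i \<otimes> v i x) y = (\<Oplus>i\<in>I. c i \<otimes> \<phi> (v i) y)"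
  using assms(3-)
proof (induction I)
  case empty
  show ?case unfolding finsum_empty by (rule lin_map_zero[OF \<phi> y])
next
  case (insert j I)
  let ?u = "\<lambda>x\<in>X. \<Oplus>i\<in>I. c i \<otimes> v i x"
  have u: "?u \<in> vecs R X"
    using insert by (intro vecs_restrict finsum_closed) (auto dest: vecs_mem)
  have vj: "v j \<in> vecs R X" "c j \<in> carrier R" using insert by auto
  have "(\<lambda>x\<in>X. \<Oplus>i\<in>insert j I. c i \<otimes> v i x) = (\<lambda>x\<in>X. ?u x \<oplus> c j \<otimes> v j x)"
  proof (rule restrict_ext)
    fix x assume x: "x \<in> X"
    have "\<And>i. i \<in> insert j I \<Longrightarrow> c i \<otimes> v i x \<in> carrier R"
      using insert.prems x by (meson m_closed vecs_mem)
    thus "(\<Oplus>i\<in>insert j I. c i \<otimes> v i x) = ?u x \<oplus> c j \<otimes> v j x"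
      using insert.hyps x by (simp add: a_comm Pi_def)
  qed
  hence "\<phi> (\<lambda>x\<in>X. \<Oplus>i\<in>insert j I. c i \<otimes> v i x) y = \<phi> ?u y \<oplus> c j \<otimes> \<phi> (v j) y"
    using lin_mapD[OF \<phi> u vj y] by (simp only:)
  also have "\<dots> = (\<Oplus>i\<in>I. c i \<otimes> \<phi> (v i) y) \<oplus> c j \<otimes> \<phi> (v j) y"
    by (subst insert.IH) (use insert.prems in auto)
  also have "\<dots> = (\<Oplus>i\<in>insert j I. c i \<otimes> \<phi> (v i) y)"
  proof -
    have "\<And>i. i \<in> insert j I \<Longrightarrow> c i \<otimes> \<phi> (v i) y \<in> carrier R"
      using insert.prems y lin_map_vecs[OF \<phi>] by (meson m_closed vecs_mem)
    thus ?thesis using insert.hyps by (simp add: a_comm Pi_def)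
  qed
  finally show ?case .
qed

lemma (in ring) lin_map_inj:
  assumes \<phi>: "lin_map R X Y \<phi>"
    and ker: "\<And>u. u \<in> vecs R X \<Longrightarrow> (\<And>y. y \<in> Y \<Longrightarrow> \<phi> u y = \<zero>) \<Longrightarrow> (\<And>x. x \<in> X \<Longrightarrow> u x = \<zero>)"
  shows "inj_on \<phi> (vecs R X)"
proof (rule inj_onI)
  fix u v assume uv: "u \<in> vecs R X" "v \<in> vecs R X" "\<phi> u = \<phi> v"
  let ?w = "\<lambda>x\<in>X. u x \<oplus> (\<ominus> \<one>) \<otimes> v x"
  have w: "?w \<in> vecs R X" using uv by (intro vecs_restrict) (auto dest: vecs_mem)
  have minus: "a \<oplus> (\<ominus> \<one>) \<otimes> b = a \<ominus> b" if "a \<in> carrier R" "b \<in> carrier R" for a b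
    using that by (simp add: l_minus a_minus_def)
  have 0: "\<phi> ?w y = \<zero>" if "y \<in> Y" for y
  proof -
    have "\<phi> ?w y = \<phi> u y \<oplus> (\<ominus> \<one>) \<otimes> \<phi> v y"
      using \<phi> uv that by (simp add: lin_map_def)
    thus ?thesis
      using uv(3) minus vecs_mem[OF lin_map_vecs[OF \<phi> uv(2)] that] by simp
  qed
  show "u = v"
  proof (rule vecs_eqI[OF uv(1,2)])
    fix x assume x: "x \<in> X"
    hence "u x \<ominus> v x = \<zero>"
      using ker[OF w 0 x] uv minus by (simp add: vecs_mem)
    thus "u x = v x" using uv x by (simp add: vecs_mem)
  qed
qed

lemma (in abelian_monoid) finsum_swap:
  assumes "finite A" "finite B" "\<And>i j. i \<in> A \<Longrightarrow> j \<in> B \<Longrightarrow> f i j \<in> carrier G"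
  shows "(\<Oplus>i\<in>A. \<Oplus>j\<in>B. f i j) = (\<Oplus>j\<in>B. \<Oplus>i\<in>A. f i j)"
  using assms(1,3)
proof (induction A)
  case empty
  thus ?case by simp
next
  case (insert a A)
  have "(\<Oplus>i\<in>insert a A. \<Oplus>j\<in>B. f i j) = (\<Oplus>j\<in>B. f a j) \<oplus> (\<Oplus>j\<in>B. \<Oplus>i\<in>A. f i j)"
    using insert assms(2) by (subst finsum_insert) (auto intro!: finsum_closed)
  also have "\<dots> = (\<Oplus>j\<in>B. f a j \<oplus> (\<Oplus>i\<in>A. f i j))"
    using insert by (subst finsum_addf) (auto intro!: finsum_closed)
  also have "\<dots> = (\<Oplus>j\<in>B. \<Oplus>i\<in>insert a A. f i j)"
    using insert by (intro finsum_cong') (auto intro!: finsum_closed)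
  finally show ?case .
qed

text \<open>Over a finite field, spaces of equal dimension have equally many vectors, so injectivity
  suffices.\<close>

lemma (in field) bij_betw_lin_map:
  assumes \<phi>: "lin_map R X Y \<phi>" and inj: "inj_on \<phi> (vecs R X)"
    and fin: "finite (carrier R)" "finite X" "finite Y" "card X = card Y"
  shows "bij_betw \<phi> (vecs R X) (vecs R Y)"
proof -
  have "card (\<phi> ` vecs R X) = card (vecs R Y)"
    using fin inj by (simp add: card_image card_vecs)
  hence "\<phi> ` vecs R X = vecs R Y"
    using \<phi> fin by (intro card_subset_eq finite_vecs) (auto simp: lin_map_vecs)
  thus ?thesis using inj by (simp add: bij_betw_def)
qed

section \<open>Reed-Solomon codes and inversion of square matrices\<close>

text \<open>The root bound for polynomials, phrased for a coefficient function: a square Vandermonde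
  matrix at distinct points has trivial kernel.\<close>

lemma (in field) polynomial_zero_if_many_roots:
  fixes t :: "nat \<Rightarrow> 'a"
  assumes fin: "finite (carrier R)" and X: "X \<subseteq> carrier R" "card X = m"
    and t: "\<And>e. e < m \<Longrightarrow> t e \<in> carrier R"
    and roots: "\<And>x. x \<in> X \<Longrightarrow> (\<Oplus>e\<in>{..<m}. t e \<otimes> x [^] e) = \<zero>"
    and e: "e < m"
  shows "t e = \<zero>"
proof (rule ccontr)
  assume nz: "t e \<noteq> \<zero>"
  interpret UP: UP_domain R "UP R" by unfold_locales simp_all
  define p where "p = (\<lambda>i. if i < m then t i else \<zero>)"
  have p: "p \<in> up R"
    unfolding up_def using t
    by (auto simp: p_def bound_def intro!: exI[of _ m])
  have pc: "p \<in> carrier (UP R)" using p by (simp add: UP_def)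
  have coeff: "coeff (UP R) p i = p i" for i using p by (simp add: UP_def)
  have p0: "p \<noteq> \<zero>\<^bsub>UP R\<^esub>"
    using nz e by (auto simp: UP_def p_def fun_eq_iff)
  \<comment> \<open>As \<open>e < m\<close>, the truncated \<open>m - 1\<close> is really below
    \<open>m\<close>; this strict gap contradicts the \<open>m\<close> roots.\<close>
  have deg: "deg R p \<le> m - 1"
  proof (rule UP.deg_aboveI[OF _ pc])
    fix i assume "m - 1 < i"
    thus "coeff (UP R) p i = \<zero>" unfolding coeff using e by (auto simp: p_def)
  qed
  have "eval R R id x p = \<zero>" if x: "x \<in> X" for x
  proof -
    have xc: "x \<in> carrier R" using x X by auto
    have "eval R R id x p = (\<Oplus>i\<in>{..deg R p}. p i \<otimes> x [^] i)"
      using pc by (simp add: eval_def coeff)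
    also have "\<dots> = (\<Oplus>i\<in>{..<m}. p i \<otimes> x [^] i)"
    proof (rule add.finprod_mono_neutral_cong_left)
      show "{..deg R p} \<subseteq> {..<m}" using deg e by auto
      fix i assume "i \<in> {..<m} - {..deg R p}"
      hence "p i = \<zero>" using UP.deg_aboveD[OF _ pc] by (simp add: coeff)
      thus "p i \<otimes> x [^] i = \<zero>" using xc by simp
    qed (use t xc in \<open>auto simp: p_def\<close>)
    also have "\<dots> = (\<Oplus>i\<in>{..<m}. t i \<otimes> x [^] i)"
      using t xc by (intro finsum_cong') (auto simp: p_def)
    finally show ?thesis using roots[OF x] by simp
  qed
  hence sub: "X \<subseteq> {a \<in> carrier R. eval R R id a p = \<zero>}" using X by auto
  have bound: "finite {a \<in> carrier R. eval R R id a p = \<zero>}"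
    "card {a \<in> carrier R. eval R R id a p = \<zero>} \<le> deg R p"
    using UP.roots_bound[OF pc p0 fin] by auto
  have "m \<le> deg R p" using card_mono[OF bound(1) sub] bound(2) X(2) by simp
  thus False using deg e by simp
qed

text \<open>A Reed-Solomon code: position \<open>p\<close> evaluates the message polynomial at its
  own point \<open>x p\<close>. Distinct points for all positions are where the lower bound on the
  field size comes from.\<close>

lemma (in field) mds_matrix_exists:
  fixes P :: "'p set" and E :: "'e set"
  assumes fin: "finite (carrier R)" "finite P" "finite E" and le: "card P \<le> card (carrier R)"
  shows "\<exists>V. mds_matrix R P E V"
proof -
  obtain x where x: "inj_on x P" "x ` P \<subseteq> carrier R"
    using card_le_inj[OF fin(2,1) le] by blast
  define m where "m = card E"
  obtain d where d: "bij_betw d E {..<m}"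
    using ex_bij_betw_finite_nat[OF fin(3)] unfolding m_def atLeast0LessThan by blast
  define V where "V p e = x p [^] d e" for p e
  have Vc: "V p e \<in> carrier R" if "p \<in> P" for p e
    using that x by (auto simp: V_def)
  have main: "t e = t' e" if Q: "Q \<subseteq> P" "card Q = card E" and t: "t \<in> E \<rightarrow> carrier R" "t' \<in> E \<rightarrow> carrier R"
    and eq: "\<And>p. p \<in> Q \<Longrightarrow> (\<Oplus>e\<in>E. V p e \<otimes> t e) = (\<Oplus>e\<in>E. V p e \<otimes> t' e)" and e: "e \<in> E" for Q t t' e
  proof -
    \<comment> \<open>The difference of the two messages, indexed by exponents: agreement on
      \<open>Q\<close> makes it a polynomial that vanishes at \<open>m\<close> points.\<close>
    define s where "s j = t (inv_into E d j) \<ominus> t' (inv_into E d j)" for j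
    have dE: "inv_into E d (d e) = e" "d e < m" if "e \<in> E" for e
      using d that by (auto simp: bij_betw_def)
    have inv: "inv_into E d j \<in> E" if "j < m" for j
      using d that by (auto simp: bij_betw_def intro: inv_into_into)
    have s: "s j \<in> carrier R" if "j < m" for j
      using inv[OF that] t by (auto simp: s_def)
    have "s (d e) = \<zero>"
    proof (rule polynomial_zero_if_many_roots[OF fin(1), of "x ` Q" m])
      show "x ` Q \<subseteq> carrier R" using x Q by auto
      show "card (x ` Q) = m" using x Q by (simp add: card_image inj_on_subset m_def)
      fix y assume "y \<in> x ` Q"
      then obtain p where p: "p \<in> Q" "y = x p" by auto
      have pc: "x p \<in> carrier R" using p Q x by auto
      have Vp: "V p e \<in> carrier R" for e using Vc p Q by auto
      have tc: "\<And>e. e \<in> E \<Longrightarrow> t e \<in> carrier R" "\<And>e. e \<in> E \<Longrightarrow> t' e \<in> carrier R"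
        using t by auto
      have "(\<Oplus>j\<in>{..<m}. s j \<otimes> y [^] j) = (\<Oplus>j\<in>d ` E. s j \<otimes> y [^] j)"
        using d by (simp add: bij_betw_def)
      also have "\<dots> = (\<Oplus>e\<in>E. s (d e) \<otimes> y [^] (d e))"
        using d s pc dE p by (intro finsum_reindex) (auto simp: bij_betw_def)
      also have "\<dots> = (\<Oplus>e\<in>E. V p e \<otimes> t e \<oplus> (\<ominus> \<one>) \<otimes> (V p e \<otimes> t' e))"
      proof (rule finsum_cong')
        fix e assume e: "e \<in> E"
        have c: "t e \<in> carrier R" "t' e \<in> carrier R" "V p e \<in> carrier R"
          using t e Vc p Q by auto
        have "s (d e) \<otimes> y [^] d e = (t e \<ominus> t' e) \<otimes> V p e"
          using dE[OF e] p by (simp add: s_def V_def)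
        also have "\<dots> = V p e \<otimes> t e \<oplus> (\<ominus> \<one>) \<otimes> (V p e \<otimes> t' e)"
          using c by algebra
        finally show "s (d e) \<otimes> y [^] d e = V p e \<otimes> t e \<oplus> (\<ominus> \<one>) \<otimes> (V p e \<otimes> t' e)" .
      qed (use tc Vp in auto)
      also have "\<dots> = (\<Oplus>e\<in>E. V p e \<otimes> t e) \<oplus> (\<ominus> \<one>) \<otimes> (\<Oplus>e\<in>E. V p e \<otimes> t' e)"
      proof -
        have "(\<lambda>e. V p e \<otimes> t e) \<in> E \<rightarrow> carrier R" "(\<lambda>e. V p e \<otimes> t' e) \<in> E \<rightarrow> carrier R"
          using t Vp by auto
        thus ?thesis
          using fin by (subst finsum_addf) (auto simp: finsum_rdistr)
      qed
      also have "\<dots> = \<zero>"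
      proof -
        have "(\<Oplus>e\<in>E. V p e \<otimes> t' e) \<in> carrier R"
          using t Vp by (intro finsum_closed) auto
        thus ?thesis unfolding eq[OF p(1)] by (simp add: l_minus r_neg)
      qed
      finally show "(\<Oplus>j\<in>{..<m}. s j \<otimes> y [^] j) = \<zero>" .
    qed (use s dE e in auto)
    thus ?thesis
      using dE[OF e] funcset_mem[OF t(1) e] funcset_mem[OF t(2) e] by (simp add: s_def)
  qed
  have "mds_matrix R P E V"
    unfolding mds_matrix_def
  proof (intro conjI allI ballI impI)
    fix Q t t' e
    assume *: "Q \<subseteq> P" "card Q = card E" "t \<in> E \<rightarrow> carrier R" "t' \<in> E \<rightarrow> carrier R"
      "\<forall>p\<in>Q. (\<Oplus>e\<in>E. V p e \<otimes> t e) = (\<Oplus>e\<in>E. V p e \<otimes> t' e)" "e \<in> E"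
    show "t e = t' e" by (rule main[OF *(1-4) bspec[OF *(5)] *(6)])
  qed (rule Vc)
  thus ?thesis by (rule exI[of _ V])
qed

text \<open>Independent columns make the square matrix invertible, so some \<open>c\<close> combines
  them to the unit vector at \<open>k0\<close>. Exchanging the sums turns \<open>c\<close> into a
  rule that reads entry \<open>k0\<close> off K combinations; a K-set of servers applies it to its
  replies.\<close>

lemma (in field) square_interpolation:
  fixes J :: "'n set"
  assumes fin: "finite (carrier R)" "finite J" "card J = K"
    and G: "\<And>k n. k < K \<Longrightarrow> n \<in> J \<Longrightarrow> G k n \<in> carrier R"
    and indep: "\<And>c. c \<in> J \<rightarrow> carrier R \<Longrightarrow> (\<And>k. k < K \<Longrightarrow> (\<Oplus>n\<in>J. c n \<otimes> G k n) = \<zero>) \<Longrightarrow>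
      (\<And>n. n \<in> J \<Longrightarrow> c n = \<zero>)"
    and k0: "k0 < K"
  shows "\<exists>c\<in>J \<rightarrow> carrier R. \<forall>h\<in>{..<K} \<rightarrow> carrier R.
    h k0 = (\<Oplus>n\<in>J. c n \<otimes> (\<Oplus>k\<in>{..<K}. G k n \<otimes> h k))"
proof -
  define \<phi> where "\<phi> c = (\<lambda>k\<in>{..<K}. \<Oplus>n\<in>J. c n \<otimes> G k n)" for c
  have lin: "lin_map R J {..<K} \<phi>"
    unfolding lin_map_def
  proof (intro conjI ballI)
    show "\<phi> \<in> vecs R J \<rightarrow> vecs R {..<K}"
      using G by (auto simp: \<phi>_def intro!: vecs_restrict finsum_closed m_closed intro: vecs_mem)
    fix u v a assume u: "u \<in> vecs R J" "v \<in> vecs R J" "a \<in> carrier R"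
    show "\<phi> (\<lambda>x\<in>J. u x \<oplus> a \<otimes> v x) = (\<lambda>y\<in>{..<K}. \<phi> u y \<oplus> a \<otimes> \<phi> v y)"
      unfolding \<phi>_def
    proof (rule restrict_ext)
      fix k assume k: "k \<in> {..<K}"
      have c: "\<And>n. n \<in> J \<Longrightarrow> u n \<in> carrier R" "\<And>n. n \<in> J \<Longrightarrow> v n \<in> carrier R"
        "\<And>n. n \<in> J \<Longrightarrow> G k n \<in> carrier R"
        using u G k by (auto dest: vecs_mem)
      have "(\<Oplus>n\<in>J. (\<lambda>x\<in>J. u x \<oplus> a \<otimes> v x) n \<otimes> G k n) =
          (\<Oplus>n\<in>J. u n \<otimes> G k n \<oplus> a \<otimes> (v n \<otimes> G k n))"
        using c u(3) by (intro finsum_cong') (auto simp: l_distr m_assoc)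
      also have "\<dots> = (\<Oplus>n\<in>J. u n \<otimes> G k n) \<oplus> a \<otimes> (\<Oplus>n\<in>J. v n \<otimes> G k n)"
        using c u(3) fin by (simp add: finsum_addf finsum_rdistr Pi_def)
      finally show "(\<Oplus>n\<in>J. (\<lambda>x\<in>J. u x \<oplus> a \<otimes> v x) n \<otimes> G k n) =
        (\<lambda>k\<in>{..<K}. \<Oplus>n\<in>J. u n \<otimes> G k n) k \<oplus> a \<otimes> (\<lambda>k\<in>{..<K}. \<Oplus>n\<in>J. v n \<otimes> G k n) k"
        using k by simp
    qed
  qed
  have inj: "inj_on \<phi> (vecs R J)"
  proof (rule lin_map_inj[OF lin])
    fix u n assume u: "u \<in> vecs R J" "\<And>k. k \<in> {..<K} \<Longrightarrow> \<phi> u k = \<zero>" and n: "n \<in> J"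
    have "(\<Oplus>n\<in>J. u n \<otimes> G k n) = \<zero>" if "k < K" for k
      using u(2)[of k] that by (simp add: \<phi>_def)
    with indep[of u n] u(1) n show "u n = \<zero>"
      by (simp add: vecs_def PiE_def)
  qed
  let ?\<delta> = "\<lambda>k\<in>{..<K}. if k = k0 then \<one> else \<zero>"
  have "?\<delta> \<in> vecs R {..<K}" by (rule vecs_restrict) auto
  moreover have "bij_betw \<phi> (vecs R J) (vecs R {..<K})"
    by (rule bij_betw_lin_map[OF lin inj fin(1,2) finite_lessThan]) (simp add: fin(3))
  ultimately have "?\<delta> \<in> \<phi> ` vecs R J"
    by (simp only: bij_betw_def)
  then obtain c where c: "c \<in> vecs R J" "?\<delta> = \<phi> c" ..
  have "h k0 = (\<Oplus>n\<in>J. c n \<otimes> (\<Oplus>k\<in>{..<K}. G k n \<otimes> h k))" if h: "h \<in> {..<K} \<rightarrow> carrier R" for h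
  proof -
    have h: "h k \<in> carrier R" if "k < K" for k using h that by auto
    have cc: "c n \<in> carrier R" if "n \<in> J" for n using c that by (auto dest: vecs_mem)
    have "(\<Oplus>n\<in>J. c n \<otimes> (\<Oplus>k\<in>{..<K}. G k n \<otimes> h k)) = (\<Oplus>n\<in>J. \<Oplus>k\<in>{..<K}. c n \<otimes> (G k n \<otimes> h k))"
      using h cc G by (intro finsum_cong') (auto simp: finsum_rdistr intro!: finsum_closed)
    also have "\<dots> = (\<Oplus>k\<in>{..<K}. \<Oplus>n\<in>J. c n \<otimes> (G k n \<otimes> h k))"
      using h cc G fin by (intro finsum_swap) auto
    also have "\<dots> = (\<Oplus>k\<in>{..<K}. \<Oplus>n\<in>J. (c n \<otimes> G k n) \<otimes> h k)"
    proof (rule finsum_cong'[OF refl])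
      fix k assume "k \<in> {..<K}"
      thus "(\<Oplus>n\<in>J. c n \<otimes> (G k n \<otimes> h k)) = (\<Oplus>n\<in>J. (c n \<otimes> G k n) \<otimes> h k)"
        using h cc G by (intro finsum_cong') (auto simp: m_assoc)
    qed (use h cc G in \<open>auto intro!: finsum_closed\<close>)
    also have "\<dots> = (\<Oplus>k\<in>{..<K}. \<phi> c k \<otimes> h k)"
      using h cc G fin by (intro finsum_cong') (auto simp: finsum_ldistr \<phi>_def intro!: finsum_closed)
    also have "\<dots> = (\<Oplus>k\<in>{..<K}. if k0 = k then h k else \<zero>)"
      using h unfolding c(2)[symmetric] by (intro finsum_cong') auto
    also have "\<dots> = h k0"
      using h k0 by (intro finsum_singleton) auto
    finally show ?thesis by simp
  qed
  thus ?thesis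
    using c by (intro bexI[of _ c]) (auto dest: vecs_mem)
qed

section \<open>The scheme\<close>

lemma (in cring) finsum_linear:
  assumes "finite E" "\<And>e. e \<in> E \<Longrightarrow> c e \<in> carrier R" "\<And>e. e \<in> E \<Longrightarrow> u e \<in> carrier R"
    "\<And>e. e \<in> E \<Longrightarrow> v e \<in> carrier R" "a \<in> carrier R"
  shows "(\<Oplus>e\<in>E. c e \<otimes> (u e \<oplus> a \<otimes> v e)) = (\<Oplus>e\<in>E. c e \<otimes> u e) \<oplus> a \<otimes> (\<Oplus>e\<in>E. c e \<otimes> v e)"
proof -
  have "(\<Oplus>e\<in>E. c e \<otimes> (u e \<oplus> a \<otimes> v e)) = (\<Oplus>e\<in>E. c e \<otimes> u e \<oplus> a \<otimes> (c e \<otimes> v e))"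
    using assms by (intro finsum_cong') (auto simp: r_distr m_lcomm)
  also have "\<dots> = (\<Oplus>e\<in>E. c e \<otimes> u e) \<oplus> (\<Oplus>e\<in>E. a \<otimes> (c e \<otimes> v e))"
    using assms by (intro finsum_addf) auto
  also have "(\<Oplus>e\<in>E. a \<otimes> (c e \<otimes> v e)) = a \<otimes> (\<Oplus>e\<in>E. c e \<otimes> v e)"
    using assms by (intro finsum_rdistr[symmetric]) auto
  finally show ?thesis .
qed

text \<open>Position \<open>(j, X)\<close> of the code \<open>V1\<close>, which carries the interference, is the query to the \<open>K\<close>-set \<open>X\<close>
  in the group whose word has the letter \<open>j\<close> at the wanted file.  The code \<open>V2\<close> carries the wanted file
  within one group.\<close>

locale group_scheme = field R for R :: "('c, 'z) ring_scheme" (structure) +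
  fixes N K T M S \<alpha> D :: nat and G :: "nat \<Rightarrow> nat \<Rightarrow> 'c"
    and V1 :: "nat \<times> nat set \<Rightarrow> nat \<times> nat \<Rightarrow> 'c" and V2 :: "nat set \<Rightarrow> nat \<Rightarrow> 'c"
    and Ks :: "nat set set"
  assumes finR: "finite (carrier R)"
    and G: "mds_generator R K N G"
    and KT: "1 \<le> K" "1 \<le> T" "T + K \<le> N"
    and \<alpha>: "\<alpha> = (N choose K) - ((N - T) choose K)" and D: "D = (N - S) choose K" and \<alpha>D: "\<alpha> < D"
    and Ks: "Ks = {X. X \<subseteq> {..<N} \<and> card X = K}"
    and V1: "mds_matrix R ({..<D} \<times> Ks) ({..<\<alpha>} \<times> {..<D}) V1"
    and V2: "mds_matrix R Ks {..<D} V2"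
begin

text \<open>The common number of coordinates of a file: \<open>(D - \<alpha>) * D ^ (M - 1)\<close>
  groups in which it is active, with \<open>D\<close> coordinates each.\<close>

definition L :: nat where "L = (D - \<alpha>) * D ^ M"

definition "words = ({..<M} \<rightarrow>\<^sub>E {..<D})"

definition active :: "(nat \<Rightarrow> nat) \<Rightarrow> nat set" where "active w = {l\<in>{..<M}. \<alpha> \<le> w l}"

definition "groups l = {w\<in>words. \<alpha> \<le> w l}"

text \<open>The same coordinate space serves file \<open>l\<close> whether it is wanted or not; only
  \<open>encode\<close> reads it differently. This is what lets one key serve every wanted
  index.\<close>

definition "coords l = groups l \<times> {..<D}"

text \<open>For the wanted file every group is a \<open>V2\<close> codeword of its own. For an
  unwanted file the \<open>D\<close> groups that agree off letter \<open>i\<close> share one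
  \<open>V1\<close> codeword, whose message is the block of coordinates with letter \<open>i\<close>
  below \<alpha>; the coordinates with \<open>\<alpha> \<le> w i\<close> are not
  transmitted.\<close>

definition encode :: "nat \<Rightarrow> nat \<Rightarrow> ((nat \<Rightarrow> nat) \<times> nat \<Rightarrow> 'c) \<Rightarrow> (nat \<Rightarrow> nat) \<times> nat set \<Rightarrow> 'c" where
  "encode i l z = (\<lambda>(w, X)\<in>groups l \<times> Ks.
     if l = i then \<Oplus>d\<in>{..<D}. V2 X d \<otimes> z (w, d)
     else \<Oplus>e\<in>{..<\<alpha>} \<times> {..<D}. V1 (w i, X) e \<otimes> z (w(i := fst e), snd e))"

text \<open>Words without active file would ask for an empty sum and are left out, which saves
  \<open>\<alpha> ^ M\<close> groups of download.\<close>

definition "slots n = {w\<in>words. active w \<noteq> {}} \<times> {X\<in>Ks. n \<in> X}"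

text \<open>One bijection per file acts on all K columns alike, so it commutes with the storage
  code. Extensionality makes keys with equal values equal, as needed to permute them.\<close>

definition "keys = (\<Pi>\<^sub>E l\<in>{..<M}. {\<sigma> \<in> vecs R {..<L} \<rightarrow>\<^sub>E vecs R (coords l).
  lin_map R {..<L} (coords l) \<sigma> \<and> bij_betw \<sigma> (vecs R {..<L}) (vecs R (coords l))})"

definition col_of :: "(nat \<times> nat \<Rightarrow> 'c) \<Rightarrow> nat \<Rightarrow> nat \<Rightarrow> 'c" where
  "col_of y l = (\<lambda>r\<in>{..<L}. y (l, r))"

definition "reply i \<sigma> n y = (\<lambda>(w, X)\<in>slots n. \<Oplus>l\<in>active w. encode i l (\<sigma> l (col_of y l)) (w, X))"

section \<open>Counting K-sets, words and coordinates\<close>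

lemma Ks_finite: "finite Ks" and Ks_card: "card Ks = N choose K"
  unfolding Ks using n_subsets[of "{..<N}" K] by (auto intro: finite_subset[of _ "Pow {..<N}"])

text \<open>Guarantees that the letter 0 switches a file off, which decoding relies on.\<close>

lemma \<alpha>_pos: "0 < \<alpha>"
proof -
  have "(N - T) choose K \<le> (N - 1) choose K" using KT by (intro binomial_right_mono) auto
  also have "\<dots> < N choose K"
    using KT by (cases N; cases K) (auto simp: zero_less_binomial_iff)
  finally show ?thesis by (simp add: \<alpha>)
qed

lemma words_finite: "finite words"
  by (simp add: words_def finite_PiE)

lemma coords_finite: "finite (coords l)"
  using words_finite by (simp add: coords_def groups_def)

lemma active_finite: "finite (active w)"
  by (simp add: active_def)

lemma groups_active: "w \<in> words \<Longrightarrow> l \<in> active w \<Longrightarrow> w \<in> groups l"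
  by (simp add: groups_def active_def)

lemma words_upd: "w \<in> words \<Longrightarrow> i < M \<Longrightarrow> a < D \<Longrightarrow> w(i := a) \<in> words"
  by (auto simp: words_def PiE_iff extensional_def)

lemma groups_upd: "w \<in> groups l \<Longrightarrow> l \<noteq> i \<Longrightarrow> i < M \<Longrightarrow> a < D \<Longrightarrow> w(i := a) \<in> groups l"
  by (simp add: groups_def words_upd)

lemma word_less: "w \<in> words \<Longrightarrow> i < M \<Longrightarrow> w i < D"
  by (auto simp: words_def)

lemma groups_words: "w \<in> groups l \<Longrightarrow> w \<in> words"
  by (simp add: groups_def)

lemma card_coords:
  assumes l: "l < M"
  shows "card (coords l) = L"
proof -
  have "groups l = (\<Pi>\<^sub>E j\<in>{..<M}. if j = l then {\<alpha>..<D} else {..<D})"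
  proof (rule Set.set_eqI)
    fix w
    have "w \<in> groups l \<longleftrightarrow> w \<in> extensional {..<M} \<and> (\<forall>j\<in>{..<M}. w j < D) \<and> \<alpha> \<le> w l"
      by (simp add: groups_def words_def PiE_iff conj_ac)
    also have "\<dots> \<longleftrightarrow> w \<in> extensional {..<M} \<and> (\<forall>j\<in>{..<M}. w j < D \<and> (j = l \<longrightarrow> \<alpha> \<le> w j))"
      using l by blast
    also have "\<dots> \<longleftrightarrow> w \<in> (\<Pi>\<^sub>E j\<in>{..<M}. if j = l then {\<alpha>..<D} else {..<D})"
    proof -
      have "w j < D \<and> (j = l \<longrightarrow> \<alpha> \<le> w j) \<longleftrightarrow> w j \<in> (if j = l then {\<alpha>..<D} else {..<D})" for j
        by auto
      thus ?thesis unfolding PiE_iff by (simp only: conj_commute)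
    qed
    finally show "w \<in> groups l \<longleftrightarrow> w \<in> (\<Pi>\<^sub>E j\<in>{..<M}. if j = l then {\<alpha>..<D} else {..<D})" .
  qed
  hence "card (groups l) = (\<Prod>j\<in>{..<M}. if j = l then D - \<alpha> else D)"
    by (simp add: card_PiE if_distrib[where f = card] cong: if_cong)
  also have "\<dots> = (D - \<alpha>) * (\<Prod>j\<in>{..<M} - {l}. if j = l then D - \<alpha> else D)"
    using l by (subst prod.remove[of _ l]) auto
  also have "(\<Prod>j\<in>{..<M} - {l}. if j = l then D - \<alpha> else D) = (\<Prod>j\<in>{..<M} - {l}. D)"
    by (intro prod.cong) auto
  also have "\<dots> = D ^ (M - 1)" using l by simp
  finally have "card (groups l) = (D - \<alpha>) * D ^ (M - 1)" .
  moreover have "D ^ M = D ^ (M - 1) * D" using l by (cases M) auto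
  ultimately show ?thesis
    by (simp add: coords_def card_cartesian_product L_def)
qed

section \<open>Linearity of the encoding and its completion to a bijection\<close>

lemma V1_closed: "j < D \<Longrightarrow> X \<in> Ks \<Longrightarrow> e \<in> {..<\<alpha>} \<times> {..<D} \<Longrightarrow> V1 (j, X) e \<in> carrier R"
  using V1 by (auto simp: mds_matrix_def)

lemma V2_closed: "X \<in> Ks \<Longrightarrow> d < D \<Longrightarrow> V2 X d \<in> carrier R"
  using V2 by (auto simp: mds_matrix_def)

lemma row_same: "w \<in> groups l \<Longrightarrow> d < D \<Longrightarrow> (w, d) \<in> coords l"
  by (simp add: coords_def)

lemma row_upd:
  "w \<in> groups l \<Longrightarrow> l \<noteq> i \<Longrightarrow> i < M \<Longrightarrow> e \<in> {..<\<alpha>} \<times> {..<D} \<Longrightarrow> (w(i := fst e), snd e) \<in> coords l"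
  using \<alpha>D by (auto simp: coords_def groups_upd)

lemma encode_wanted:
  "w \<in> groups i \<Longrightarrow> X \<in> Ks \<Longrightarrow> encode i i z (w, X) = (\<Oplus>d\<in>{..<D}. V2 X d \<otimes> z (w, d))"
  by (simp add: encode_def)

lemma encode_unwanted:
  "w \<in> groups l \<Longrightarrow> X \<in> Ks \<Longrightarrow> l \<noteq> i \<Longrightarrow>
   encode i l z (w, X) = (\<Oplus>e\<in>{..<\<alpha>} \<times> {..<D}. V1 (w i, X) e \<otimes> z (w(i := fst e), snd e))"
  by (simp add: encode_def)

lemma encode_lin:
  assumes i: "i < M"
  shows "lin_map R (coords l) (groups l \<times> Ks) (encode i l)"
  unfolding lin_map_def
proof (intro conjI ballI funcsetI)
  fix z assume z: "z \<in> vecs R (coords l)"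
  have "encode i l z p \<in> carrier R" if p: "p \<in> groups l \<times> Ks" for p
  proof -
    obtain w X where wX: "p = (w, X)" "w \<in> groups l" "X \<in> Ks" using p by auto
    show ?thesis
    proof (cases "l = i")
      case True
      have "V2 X d \<otimes> z (w, d) \<in> carrier R" if "d < D" for d
        using wX V2_closed vecs_mem[OF z row_same] that by simp
      thus ?thesis using wX True by (auto simp: encode_wanted intro!: finsum_closed)
    next
      case False
      have "V1 (w i, X) e \<otimes> z (w(i := fst e), snd e) \<in> carrier R" if "e \<in> {..<\<alpha>} \<times> {..<D}" for e
        using wX V1_closed[OF word_less[OF groups_words i]] vecs_mem[OF z row_upd[OF _ False i]] that
        by blast
      thus ?thesis
        unfolding wX(1) encode_unwanted[OF wX(2,3) False] by (intro finsum_closed) blast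
    qed
  qed
  thus "encode i l z \<in> vecs R (groups l \<times> Ks)"
    unfolding vecs_def by (rule PiE_I) (auto simp: encode_def)
next
  fix u v a assume u: "u \<in> vecs R (coords l)" and v: "v \<in> vecs R (coords l)" and a: "a \<in> carrier R"
  let ?uv = "\<lambda>x\<in>coords l. u x \<oplus> a \<otimes> v x"
  have pt: "encode i l ?uv p = encode i l u p \<oplus> a \<otimes> encode i l v p" if p: "p \<in> groups l \<times> Ks" for p
  proof -
    obtain w X where wX: "p = (w, X)" "w \<in> groups l" "X \<in> Ks" using p by auto
    show ?thesis
    proof (cases "l = i")
      case True
      have "encode i l ?uv p = (\<Oplus>d\<in>{..<D}. V2 X d \<otimes> (u (w, d) \<oplus> a \<otimes> v (w, d)))"
        using wX True V2_closed a vecs_mem[OF u row_same] vecs_mem[OF v row_same]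
        by (simp only: encode_wanted, intro finsum_cong') (auto simp: row_same)
      also have "\<dots> = (\<Oplus>d\<in>{..<D}. V2 X d \<otimes> u (w, d)) \<oplus> a \<otimes> (\<Oplus>d\<in>{..<D}. V2 X d \<otimes> v (w, d))"
        by (rule finsum_linear)
          (use wX True V2_closed a vecs_mem[OF u row_same] vecs_mem[OF v row_same] in auto)
      finally show ?thesis using wX True by (simp add: encode_wanted)
    next
      case False
      let ?E = "{..<\<alpha>} \<times> {..<D}" and ?f = "\<lambda>e. (w(i := fst e), snd e)"
      have c: "V1 (w i, X) e \<in> carrier R" "u (?f e) \<in> carrier R" "v (?f e) \<in> carrier R"
          "?f e \<in> coords l" if "e \<in> ?E" for e
        using V1_closed[OF word_less[OF groups_words[OF wX(2)] i] wX(3) that]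
          row_upd[OF wX(2) False i that] vecs_mem[OF u] vecs_mem[OF v] by blast+
      have "encode i l ?uv p = (\<Oplus>e\<in>?E. V1 (w i, X) e \<otimes> (u (?f e) \<oplus> a \<otimes> v (?f e)))"
        unfolding wX(1) encode_unwanted[OF wX(2,3) False]
      proof (rule finsum_cong'[OF refl])
        show "(\<lambda>e. V1 (w i, X) e \<otimes> (u (?f e) \<oplus> a \<otimes> v (?f e))) \<in> ?E \<rightarrow> carrier R"
          using c(1-3) a by (intro funcsetI m_closed a_closed) auto
        show "V1 (w i, X) e \<otimes> ?uv (?f e) = V1 (w i, X) e \<otimes> (u (?f e) \<oplus> a \<otimes> v (?f e))" if "e \<in> ?E" for e
          using c(4)[OF that] by (simp only: restrict_apply' )
      qed
      also have "\<dots> = (\<Oplus>e\<in>?E. V1 (w i, X) e \<otimes> u (?f e)) \<oplus> a \<otimes> (\<Oplus>e\<in>?E. V1 (w i, X) e \<otimes> v (?f e))"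
        by (rule finsum_linear[OF _ c(1) c(2) c(3) a]) simp
      finally show ?thesis unfolding wX(1) encode_unwanted[OF wX(2,3) False] .
    qed
  qed
  show "encode i l ?uv = (\<lambda>p\<in>groups l \<times> Ks. encode i l u p \<oplus> a \<otimes> encode i l v p)"
  proof
    fix p
    show "encode i l ?uv p = (\<lambda>p\<in>groups l \<times> Ks. encode i l u p \<oplus> a \<otimes> encode i l v p) p"
    proof (cases "p \<in> groups l \<times> Ks")
      case True
      thus ?thesis by (simp only: pt restrict_apply')
    qed (simp add: encode_def restrict_apply)
  qed
qed

text \<open>The square linear map whose coordinates \<open>(w, d)\<close> with \<open>d < \<alpha>\<close> are the encoded symbols at the
  positions \<open>\<rho> d\<close>.  For an unwanted file these involve only the coordinates with \<open>w i < \<alpha>\<close>;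
  the others are permuted.\<close>

definition completion ::
  "(nat \<Rightarrow> nat set) \<Rightarrow> nat \<Rightarrow> nat \<Rightarrow> ((nat \<Rightarrow> nat) \<times> nat \<Rightarrow> 'c) \<Rightarrow> (nat \<Rightarrow> nat) \<times> nat \<Rightarrow> 'c" where
  "completion \<rho> i l z = (\<lambda>(w, d)\<in>coords l.
     if l = i \<or> d < \<alpha> then encode i l z (w, \<rho> d) else z (w(i := d), w i))"

text \<open>Injectivity is MDS decoding. For the wanted file the \<open>D\<close> positions
  \<open>\<rho> d\<close> determine the \<open>V2\<close> message of each group. For an unwanted
  one, \<open>D\<close> groups at \<open>\<alpha>\<close> positions give \<open>\<alpha> * D\<close>
  symbols of a \<open>V1\<close> codeword, hence its message; all other coordinates are
  copied.\<close>

lemma completion_bij: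
  assumes i: "i < M" and l: "l < M" and \<rho>: "inj_on \<rho> {..<D}" "\<rho> ` {..<D} \<subseteq> Ks"
  shows "lin_map R (coords l) (coords l) (completion \<rho> i l)"
    and "bij_betw (completion \<rho> i l) (vecs R (coords l)) (vecs R (coords l))"
proof -
  let ?P = "completion \<rho> i l"
  have row: "(w, \<rho> d) \<in> groups l \<times> Ks" if "(w, d) \<in> coords l" for w d
    using that \<rho> by (auto simp: coords_def)
  \<comment> \<open>Exchanging \<open>d\<close> with the letter \<open>w i\<close> matches the free
    rows, those with \<open>\<alpha> \<le> d\<close>, to the coordinates whose letter
    \<open>i\<close> is at least \<alpha>; as \<open>l \<noteq> i\<close>, the word stays in
    \<open>groups l\<close>.\<close>
  have row': "(w(i := d), w i) \<in> coords l" if "(w, d) \<in> coords l" "l \<noteq> i" for w d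
    using that i by (auto simp: coords_def groups_upd word_less groups_words)
  have app: "?P z (w, d) = (if l = i \<or> d < \<alpha> then encode i l z (w, \<rho> d) else z (w(i := d), w i))"
    if "(w, d) \<in> coords l" for z w d
    using that by (simp add: completion_def)
  show lin: "lin_map R (coords l) (coords l) ?P"
    unfolding lin_map_def
  proof (intro conjI ballI funcsetI)
    fix z assume z: "z \<in> vecs R (coords l)"
    have "?P z p \<in> carrier R" if p: "p \<in> coords l" for p
    proof -
      obtain w d where wd: "p = (w, d)" by (cases p)
      show ?thesis
        using p row[of w d] row'[of w d] vecs_mem[OF z] vecs_mem[OF lin_map_vecs[OF encode_lin[OF i] z]]
        unfolding wd by (auto simp: app)
    qed
    thus "?P z \<in> vecs R (coords l)"
      unfolding vecs_def by (rule PiE_I) (auto simp: completion_def)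
  next
    fix u v a assume u: "u \<in> vecs R (coords l)" and v: "v \<in> vecs R (coords l)" and a: "a \<in> carrier R"
    have pt: "?P (\<lambda>x\<in>coords l. u x \<oplus> a \<otimes> v x) p = ?P u p \<oplus> a \<otimes> ?P v p" if p: "p \<in> coords l" for p
    proof -
      obtain w d where wd: "p = (w, d)" by (cases p)
      have wd': "(w, d) \<in> coords l" using p wd by simp
      show ?thesis
      proof (cases "l = i \<or> d < \<alpha>")
        case True
        thus ?thesis
          unfolding wd app[OF wd'] using lin_mapD[OF encode_lin[OF i] u v a row[OF wd']] by simp
      next
        case False
        thus ?thesis
          unfolding wd app[OF wd'] using row'[OF wd'] by simp
      qed
    qed
    show "?P (\<lambda>x\<in>coords l. u x \<oplus> a \<otimes> v x) = (\<lambda>p\<in>coords l. ?P u p \<oplus> a \<otimes> ?P v p)"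
    proof
      fix p
      show "?P (\<lambda>x\<in>coords l. u x \<oplus> a \<otimes> v x) p = (\<lambda>p\<in>coords l. ?P u p \<oplus> a \<otimes> ?P v p) p"
      proof (cases "p \<in> coords l")
        case True
        thus ?thesis by (simp only: pt restrict_apply')
      qed (simp add: completion_def restrict_apply)
    qed
  qed
  have inj: "inj_on ?P (vecs R (coords l))"
  proof (rule inj_onI)
    fix u v assume u: "u \<in> vecs R (coords l)" and v: "v \<in> vecs R (coords l)" and eq: "?P u = ?P v"
    have eq': "?P u (w, d) = ?P v (w, d)" for w d using eq by simp
    show "u = v"
    proof (rule vecs_eqI[OF u v])
      fix p assume p: "p \<in> coords l"
      then obtain w d where wd: "p = (w, d)" "w \<in> groups l" "d < D" by (auto simp: coords_def)
      show "u p = v p"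
      proof (cases "l = i")
        case True
        have "u (w, d) = v (w, d)"
        proof (rule mds_matrixD[OF V2, where Q = "\<rho> ` {..<D}" and t = "\<lambda>d. u (w, d)"
              and t' = "\<lambda>d. v (w, d)"])
          show "\<rho> ` {..<D} \<subseteq> Ks" by fact
          show "card (\<rho> ` {..<D}) = card {..<D}" using \<rho> by (simp add: card_image)
          show "u (w, d) \<in> carrier R" "v (w, d) \<in> carrier R" if "d \<in> {..<D}" for d
            using wd(2) vecs_mem[OF u row_same] vecs_mem[OF v row_same] that by auto
          show "d \<in> {..<D}" using wd by simp
          fix X assume "X \<in> \<rho> ` {..<D}"
          then obtain d where d: "d < D" "X = \<rho> d" by auto
          hence X: "X \<in> Ks" using \<rho> by auto
          show "(\<Oplus>d\<in>{..<D}. V2 X d \<otimes> u (w, d)) = (\<Oplus>d\<in>{..<D}. V2 X d \<otimes> v (w, d))"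
            using eq'[of w d] app[OF row_same[OF wd(2) d(1)], of u]
              app[OF row_same[OF wd(2) d(1)], of v] X d wd True
            by (simp add: encode_wanted)
        qed
        thus ?thesis using wd by simp
      next
        case False
        have wi: "w i < D" using wd i by (simp add: word_less groups_words)
        show ?thesis
        proof (cases "w i < \<alpha>")
          case True
          \<comment> \<open>\<open>?Q\<close> collects all \<open>D\<close> groups of the bundle
            through \<open>w\<close> at the first \<open>\<alpha>\<close> positions, as many symbols
            as the message has.\<close>
          let ?E = "{..<\<alpha>} \<times> {..<D}" and ?Q = "{..<D} \<times> \<rho> ` {..<\<alpha>}"
          let ?f = "\<lambda>e. (w(i := fst e), snd e)"
          have f: "?f e \<in> coords l" if "e \<in> ?E" for e
            using row_upd[OF wd(2) False i that] .
          \<comment> \<open>\<open>?f (w i, d)\<close> is \<open>(w, d)\<close> itself, the letter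
            being replaced by its own value.\<close>
          have "u (?f (w i, d)) = v (?f (w i, d))"
          proof (rule mds_matrixD[OF V1, where Q = ?Q and t = "\<lambda>e. u (?f e)" and t' = "\<lambda>e. v (?f e)"])
            show "?Q \<subseteq> {..<D} \<times> Ks" using \<rho> \<alpha>D by force
            have "inj_on \<rho> {..<\<alpha>}" using \<alpha>D by (intro inj_on_subset[OF \<rho>(1)]) auto
            thus "card ?Q = card ?E" by (simp add: card_cartesian_product card_image)
            show "u (?f e) \<in> carrier R" "v (?f e) \<in> carrier R" if "e \<in> ?E" for e
              using f[OF that] vecs_mem[OF u] vecs_mem[OF v] by blast+
            show "(w i, d) \<in> ?E" using True wd by simp
            fix q assume "q \<in> ?Q"
            then obtain j d where q: "q = (j, \<rho> d)" "j < D" "d < \<alpha>" by auto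
            have g: "w(i := j) \<in> groups l" using groups_upd[OF wd(2) False i q(2)] .
            have X: "\<rho> d \<in> Ks" and dD: "d < D" using q \<alpha>D \<rho> by auto
            have "encode i l u (w(i := j), \<rho> d) = encode i l v (w(i := j), \<rho> d)"
              using eq'[of "w(i := j)" d] q(3) row_same[OF g dD] by (simp add: app)
            thus "(\<Oplus>e\<in>?E. V1 q e \<otimes> u (?f e)) = (\<Oplus>e\<in>?E. V1 q e \<otimes> v (?f e))"
              unfolding encode_unwanted[OF g X False] q(1) by simp
          qed
          thus ?thesis
            using wd by simp
        next
          case nl: False
          \<comment> \<open>The exchange is an involution: coordinate \<open>(w, d)\<close> is
            copied to row \<open>(w(i := d), w i)\<close>.\<close>
          have "(w(i := d), w i) \<in> coords l"
            using row'[of w d] wd False by (simp add: row_same)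
          from app[OF this, of u] app[OF this, of v] show ?thesis
            using eq'[of "w(i := d)" "w i"] nl False wd by simp
        qed
      qed
    qed
  qed
  show "bij_betw ?P (vecs R (coords l)) (vecs R (coords l))"
    by (rule bij_betw_lin_map[OF lin inj finR coords_finite coords_finite refl])
qed

section \<open>Privacy against T servers\<close>

text \<open>Counting the K-sets that avoid \<open>A\<close> shows that exactly \<alpha> of them meet
  it; these get the first indices. K-sets avoiding \<open>A\<close> fill up to \<open>D\<close>,
  which is possible as \<open>D \<le> N choose K\<close>, to make \<open>completion\<close>
  square.\<close>

lemma visible_positions:
  assumes A: "A \<subseteq> {..<N}" "card A = T"
  shows "\<exists>\<rho>. inj_on \<rho> {..<D} \<and> \<rho> ` {..<D} \<subseteq> Ks \<and> \<rho> ` {..<\<alpha>} = {X\<in>Ks. X \<inter> A \<noteq> {}}"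
proof -
  let ?V = "{X\<in>Ks. X \<inter> A \<noteq> {}}"
  have "Ks - ?V = {X. X \<subseteq> {..<N} - A \<and> card X = K}" by (auto simp: Ks)
  hence "card (Ks - ?V) = (N - T) choose K"
    using A n_subsets[of "{..<N} - A" K] by (simp add: card_Diff_subset finite_subset)
  moreover have "card (Ks - ?V) = card Ks - card ?V"
    using Ks_finite by (intro card_Diff_subset) auto
  moreover have "card ?V \<le> card Ks" using Ks_finite by (intro card_mono) auto
  ultimately have cV: "card ?V = \<alpha>" using \<alpha> Ks_card by linarith
  have cR: "D - \<alpha> \<le> card (Ks - ?V)"
  proof -
    have "D \<le> N choose K" unfolding D by (intro binomial_right_mono) auto
    thus ?thesis using \<open>card (Ks - ?V) = card Ks - card ?V\<close> cV Ks_card by simp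
  qed
  obtain \<rho>1 where \<rho>1: "bij_betw \<rho>1 {..<\<alpha>} ?V"
    using ex_bij_betw_nat_finite[of ?V] Ks_finite cV by (auto simp: atLeast0LessThan)
  obtain \<rho>2 where \<rho>2: "inj_on \<rho>2 {\<alpha>..<D}" "\<rho>2 ` {\<alpha>..<D} \<subseteq> Ks - ?V"
    using card_le_inj[of "{\<alpha>..<D}" "Ks - ?V"] Ks_finite cR by auto
  define \<rho> where "\<rho> d = (if d < \<alpha> then \<rho>1 d else \<rho>2 d)" for d
  have im: "\<rho> ` {..<\<alpha>} = ?V" "\<rho> ` {\<alpha>..<D} \<subseteq> Ks - ?V"
    using \<rho>1 \<rho>2 by (auto simp: \<rho>_def bij_betw_def)
  have split: "{..<D} = {..<\<alpha>} \<union> {\<alpha>..<D}" using \<alpha>D by auto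
  have "inj_on \<rho> {..<\<alpha>}" "inj_on \<rho> {\<alpha>..<D}"
    using \<rho>1 \<rho>2 by (auto simp: \<rho>_def bij_betw_def inj_on_def)
  hence "inj_on \<rho> {..<D}"
    unfolding split inj_on_Un using im by auto
  moreover have "\<rho> ` {..<D} \<subseteq> Ks" unfolding split image_Un using im by auto
  ultimately show ?thesis using im by blast
qed

lemma keys_mem:
  assumes "\<sigma> \<in> keys" "l < M"
  shows "\<sigma> l \<in> vecs R {..<L} \<rightarrow>\<^sub>E vecs R (coords l)" "lin_map R {..<L} (coords l) (\<sigma> l)"
    "bij_betw (\<sigma> l) (vecs R {..<L}) (vecs R (coords l))"
  using assms by (auto simp: keys_def)

lemma keys_finite: "finite keys"
  unfolding keys_def
proof (rule finite_PiE)
  fix l assume "l \<in> {..<M}"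
  have "finite (vecs R {..<L} \<rightarrow>\<^sub>E vecs R (coords l))"
    using finR coords_finite by (intro finite_PiE finite_vecs) auto
  thus "finite {\<sigma> \<in> vecs R {..<L} \<rightarrow>\<^sub>E vecs R (coords l).
      lin_map R {..<L} (coords l) \<sigma> \<and> bij_betw \<sigma> (vecs R {..<L}) (vecs R (coords l))}"
    by simp
qed simp

text \<open>Renaming the indices along a bijection between \<open>coords l\<close> and
  \<open>{..<L}\<close> is such a linear bijection.\<close>

lemma keys_nonempty: "keys \<noteq> {}"
  unfolding keys_def PiE_eq_empty_iff
proof (rule notI, elim bexE)
  fix l assume l: "l \<in> {..<M}" and e: "{\<sigma> \<in> vecs R {..<L} \<rightarrow>\<^sub>E vecs R (coords l).
      lin_map R {..<L} (coords l) \<sigma> \<and> bij_betw \<sigma> (vecs R {..<L}) (vecs R (coords l))} = {}"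
  have card: "card (coords l) = card {..<L}" using l card_coords by simp
  obtain g where g: "bij_betw g (coords l) {..<L}"
    using finite_same_card_bij[OF coords_finite finite_lessThan card] by blast
  have gL: "g p \<in> {..<L}" if "p \<in> coords l" for p using g that by (auto simp: bij_betw_def)
  define \<sigma> where "\<sigma> = (\<lambda>y\<in>vecs R {..<L}. \<lambda>p\<in>coords l. y (g p))"
  have into: "\<sigma> \<in> vecs R {..<L} \<rightarrow>\<^sub>E vecs R (coords l)"
    unfolding \<sigma>_def
  proof (rule restrict_PiE_iff[THEN iffD2], rule ballI, rule vecs_restrict)
    fix y p assume y: "y \<in> vecs R {..<L}" and p: "p \<in> coords l"
    show "y (g p) \<in> carrier R" by (rule vecs_mem[OF y gL[OF p]])
  qed
  have lin: "lin_map R {..<L} (coords l) \<sigma>"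
    unfolding lin_map_def
  proof (intro conjI ballI)
    show "\<sigma> \<in> vecs R {..<L} \<rightarrow> vecs R (coords l)" using into by blast
    fix u v a assume uv: "u \<in> vecs R {..<L}" "v \<in> vecs R {..<L}" "a \<in> carrier R"
    have "(\<lambda>x\<in>{..<L}. u x \<oplus> a \<otimes> v x) \<in> vecs R {..<L}"
      using uv vecs_mem[OF uv(1)] vecs_mem[OF uv(2)] by (intro vecs_restrict) auto
    thus "\<sigma> (\<lambda>x\<in>{..<L}. u x \<oplus> a \<otimes> v x) = (\<lambda>y\<in>coords l. \<sigma> u y \<oplus> a \<otimes> \<sigma> v y)"
      using uv gL unfolding \<sigma>_def by (intro ext) (simp add: restrict_def)
  qed
  have "inj_on \<sigma> (vecs R {..<L})"
  proof (rule inj_onI)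
    fix u v assume u: "u \<in> vecs R {..<L}" and v: "v \<in> vecs R {..<L}" and eq: "\<sigma> u = \<sigma> v"
    show "u = v"
    proof (rule vecs_eqI[OF u v])
      fix r assume "r \<in> {..<L}"
      hence "r \<in> g ` coords l" using g by (simp only: bij_betw_def)
      then obtain p where p: "p \<in> coords l" "r = g p" by blast
      have "\<sigma> u p = \<sigma> v p" using eq by simp
      thus "u r = v r" using u v p by (simp add: \<sigma>_def)
    qed
  qed
  from bij_betw_lin_map[OF lin this finR finite_lessThan coords_finite card[symmetric]]
  have "\<sigma> \<in> {\<sigma> \<in> vecs R {..<L} \<rightarrow>\<^sub>E vecs R (coords l).
      lin_map R {..<L} (coords l) \<sigma> \<and> bij_betw \<sigma> (vecs R {..<L}) (vecs R (coords l))}"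
    using into lin by simp
  thus False unfolding e by simp
qed

abbreviation "files \<equiv> file_tuples R M L K"

definition file_col :: "(nat \<Rightarrow> 'c file_matrix) \<Rightarrow> nat \<Rightarrow> nat \<Rightarrow> nat \<Rightarrow> 'c" where
  "file_col W l k = (\<lambda>r\<in>{..<L}. W l (r, k))"

lemma G_closed: "k < K \<Longrightarrow> n < N \<Longrightarrow> G k n \<in> carrier R"
  using G by (simp add: mds_generator_def)

lemma file_closed: "W \<in> files \<Longrightarrow> l < M \<Longrightarrow> r < L \<Longrightarrow> k < K \<Longrightarrow> W l (r, k) \<in> carrier R"
  unfolding file_tuples_def by (auto dest!: PiE_mem[where x = l] PiE_mem[where x = "(r, k)"])

lemma file_col_vecs: "W \<in> files \<Longrightarrow> l < M \<Longrightarrow> k < K \<Longrightarrow> file_col W l k \<in> vecs R {..<L}"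
  unfolding file_col_def by (rule vecs_restrict) (simp add: file_closed)

lemma col_stored:
  assumes "W \<in> files" "l < M" "n < N"
  shows "col_of (stored R M L K G W n) l = (\<lambda>r\<in>{..<L}. \<Oplus>k\<in>{..<K}. G k n \<otimes> file_col W l k r)"
  unfolding col_of_def
proof (rule restrict_ext)
  fix r assume r: "r \<in> {..<L}"
  have "stored R M L K G W n (l, r) = (\<Oplus>k\<in>{..<K}. W l (r, k) \<otimes> G k n)"
    using assms r by (simp add: stored_def)
  also have "\<dots> = (\<Oplus>k\<in>{..<K}. G k n \<otimes> file_col W l k r)"
    using assms r file_closed[OF assms(1,2)] G_closed
    by (intro finsum_cong') (auto simp: file_col_def m_comm)
  finally show "stored R M L K G W n (l, r) = (\<Oplus>k\<in>{..<K}. G k n \<otimes> file_col W l k r)" .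
qed

lemma col_stored_vecs:
  assumes "W \<in> files" "l < M" "n < N"
  shows "col_of (stored R M L K G W n) l \<in> vecs R {..<L}"
  unfolding col_stored[OF assms]
  using assms G_closed vecs_mem[OF file_col_vecs[OF assms(1,2)]]
  by (intro vecs_restrict finsum_closed) auto

lemma encode_completion:
  assumes "w \<in> groups l" "d < \<alpha>"
  shows "encode i l z (w, \<rho> d) = completion \<rho> i l z (w, d)"
  using assms \<alpha>D by (simp add: completion_def coords_def)

lemma slots_mem:
  assumes "(w, X) \<in> slots n"
  shows "w \<in> words" "active w \<noteq> {}" "X \<in> Ks" "n \<in> X" "n < N"
proof -
  show *: "w \<in> words" "active w \<noteq> {}" "X \<in> Ks" "n \<in> X" using assms by (auto simp: slots_def)
  have "X \<subseteq> {..<N}" using *(3) unfolding Ks by simp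
  thus "n < N" using *(4) by auto
qed

text \<open>The canonical scheme \<open>can\<close> sends row \<open>\<nu> X\<close> of the key
  without encoding. Composing a key for index \<open>i\<close> with \<open>completion\<close> gives
  the canonical key with the same visible symbols, and this composition permutes the finite set
  \<open>keys\<close> because it is injective.\<close>

lemma privacy:
  assumes A: "A \<subseteq> {..<N}" "card A = T"
  shows "\<exists>can \<phi>. \<forall>i<M. bij_betw (\<phi> i) keys keys \<and>
    (\<forall>\<sigma>\<in>keys. \<forall>n\<in>A. \<forall>W\<in>files.
       reply i \<sigma> n (stored R M L K G W n) = can (\<phi> i \<sigma>) n (stored R M L K G W n))"
proof -
  obtain \<rho> where \<rho>: "inj_on \<rho> {..<D}" "\<rho> ` {..<D} \<subseteq> Ks" "\<rho> ` {..<\<alpha>} = {X\<in>Ks. X \<inter> A \<noteq> {}}"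
    using visible_positions[OF A] by blast
  define \<nu> where "\<nu> = inv_into {..<\<alpha>} \<rho>"
  define can where "can \<sigma> n y = (\<lambda>(w, X)\<in>slots n. \<Oplus>l\<in>active w. \<sigma> l (col_of y l) (w, \<nu> X))"
    for \<sigma> :: "nat \<Rightarrow> (nat \<Rightarrow> 'c) \<Rightarrow> (nat \<Rightarrow> nat) \<times> nat \<Rightarrow> 'c" and n y
  define \<phi> where "\<phi> i \<sigma> = (\<lambda>l\<in>{..<M}. compose (vecs R {..<L}) (completion \<rho> i l) (\<sigma> l))"
    for i and \<sigma> :: "nat \<Rightarrow> (nat \<Rightarrow> 'c) \<Rightarrow> (nat \<Rightarrow> nat) \<times> nat \<Rightarrow> 'c"
  have bij: "bij_betw (\<phi> i) keys keys" if i: "i < M" for i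
  proof -
    note P = completion_bij[OF i _ \<rho>(1,2)]
    have "\<phi> i \<sigma> \<in> keys" if \<sigma>: "\<sigma> \<in> keys" for \<sigma>
      unfolding keys_def \<phi>_def
    proof (rule restrict_PiE_iff[THEN iffD2], rule ballI)
      fix l assume "l \<in> {..<M}"
      hence l: "l < M" by simp
      let ?c = "compose (vecs R {..<L}) (completion \<rho> i l) (\<sigma> l)"
      have lin: "lin_map R {..<L} (coords l) ?c"
        by (rule lin_map_compose[OF keys_mem(2)[OF \<sigma> l] P(1)[OF l]])
      have "bij_betw ?c (vecs R {..<L}) (vecs R (coords l))"
        by (rule bij_betw_compose[OF keys_mem(3)[OF \<sigma> l] P(2)[OF l]])
      moreover have "?c \<in> vecs R {..<L} \<rightarrow>\<^sub>E vecs R (coords l)"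
        using lin by (auto simp: lin_map_def PiE_def compose_def)
      ultimately show "?c \<in> {\<sigma> \<in> vecs R {..<L} \<rightarrow>\<^sub>E vecs R (coords l).
          lin_map R {..<L} (coords l) \<sigma> \<and> bij_betw \<sigma> (vecs R {..<L}) (vecs R (coords l))}"
        using lin by simp
    qed
    hence into: "\<phi> i ` keys \<subseteq> keys" by blast
    have "inj_on (\<phi> i) keys"
    proof (rule inj_onI)
      fix \<sigma> \<tau> assume \<sigma>: "\<sigma> \<in> keys" and \<tau>: "\<tau> \<in> keys" and eq: "\<phi> i \<sigma> = \<phi> i \<tau>"
      show "\<sigma> = \<tau>"
      proof (rule PiE_ext[OF \<sigma>[unfolded keys_def] \<tau>[unfolded keys_def]])
        fix l assume "l \<in> {..<M}"
        hence l: "l < M" by simp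
        show "\<sigma> l = \<tau> l"
        proof (rule PiE_ext[OF keys_mem(1)[OF \<sigma> l] keys_mem(1)[OF \<tau> l]])
          fix y assume y: "y \<in> vecs R {..<L}"
          have "\<phi> i \<sigma> l y = \<phi> i \<tau> l y" using eq by simp
          hence "completion \<rho> i l (\<sigma> l y) = completion \<rho> i l (\<tau> l y)"
            using l y by (simp add: \<phi>_def compose_def)
          thus "\<sigma> l y = \<tau> l y"
            using P(2)[OF l] lin_map_vecs[OF keys_mem(2)[OF \<sigma> l] y] lin_map_vecs[OF keys_mem(2)[OF \<tau> l] y]
            by (meson bij_betw_def inj_onD)
        qed
      qed
    qed
    thus ?thesis
      using endo_inj_surj[OF keys_finite into] by (simp add: bij_betw_def)
  qed
  have "reply i \<sigma> n (stored R M L K G W n) = can (\<phi> i \<sigma>) n (stored R M L K G W n)"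
    if i: "i < M" and \<sigma>: "\<sigma> \<in> keys" and n: "n \<in> A" and W: "W \<in> files" for i \<sigma> n W
    unfolding reply_def can_def
  proof (rule restrict_ext, clarify)
    fix w X assume s: "(w, X) \<in> slots n"
    note s = slots_mem[OF s]
    \<comment> \<open>A server of \<open>A\<close> is asked only for K-sets that contain it, so
      these meet \<open>A\<close> and have indices below \<alpha>.\<close>
    have X: "X \<in> \<rho> ` {..<\<alpha>}" using s n unfolding \<rho>(3) by auto
    have \<nu>: "\<nu> X < \<alpha>" "\<rho> (\<nu> X) = X"
      using inv_into_into[OF X] f_inv_into_f[OF X] by (simp_all add: \<nu>_def)
    have e: "encode i l (\<sigma> l (col_of (stored R M L K G W n) l)) (w, X) =
      \<phi> i \<sigma> l (col_of (stored R M L K G W n) l) (w, \<nu> X)" if l: "l \<in> active w" for l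
    proof -
      have lM: "l < M" using l by (simp add: active_def)
      show ?thesis
        using encode_completion[OF groups_active[OF s(1) l] \<nu>(1), of i _ \<rho>] lM
          col_stored_vecs[OF W lM s(5)]
        by (simp add: \<nu>(2) \<phi>_def compose_def)
    qed
    have "encode i l (\<sigma> l (col_of (stored R M L K G W n) l)) (w, X) \<in> carrier R" if l: "l \<in> active w" for l
    proof -
      have lM: "l < M" using l by (simp add: active_def)
      show ?thesis
        using groups_active[OF s(1) l] s(3)
        by (intro vecs_mem[OF lin_map_vecs[OF encode_lin[OF i]
              lin_map_vecs[OF keys_mem(2)[OF \<sigma> lM] col_stored_vecs[OF W lM s(5)]]]]) simp
    qed
    thus "(\<Oplus>l\<in>active w. encode i l (\<sigma> l (col_of (stored R M L K G W n) l)) (w, X)) =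
        (\<Oplus>l\<in>active w. \<phi> i \<sigma> l (col_of (stored R M L K G W n) l) (w, \<nu> X))"
      using e by (intro finsum_cong') auto
  qed
  thus ?thesis using bij by blast
qed

section \<open>Decoding the wanted file\<close>

text \<open>All unwanted files use the same code, so their sum is the codeword of the summed
  messages. \<open>\<Lambda>\<close> is a parameter because decoding needs this both for groups
  without file \<open>i\<close> and for the rest of a group that contains it.\<close>

lemma interference:
  assumes i: "i < M" and w: "w \<in> words" and X: "X \<in> Ks"
    and \<Lambda>: "\<Lambda> \<subseteq> active w - {i}" and z: "\<And>l. l \<in> \<Lambda> \<Longrightarrow> z l \<in> vecs R (coords l)"
  shows "(\<Oplus>l\<in>\<Lambda>. encode i l (z l) (w, X)) =
    (\<Oplus>e\<in>{..<\<alpha>} \<times> {..<D}. V1 (w i, X) e \<otimes> (\<Oplus>l\<in>\<Lambda>. z l (w(i := fst e), snd e)))"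
proof -
  let ?E = "{..<\<alpha>} \<times> {..<D}" and ?f = "\<lambda>e. (w(i := fst e), snd e)"
  have fin: "finite \<Lambda>" using \<Lambda> active_finite by (meson finite_Diff finite_subset)
  have l: "w \<in> groups l" "l \<noteq> i" if "l \<in> \<Lambda>" for l
    using that \<Lambda> groups_active[OF w] by auto
  have zc: "z l (?f e) \<in> carrier R" if "l \<in> \<Lambda>" "e \<in> ?E" for l e
    using vecs_mem[OF z row_upd] l that i by blast
  have vc: "V1 (w i, X) e \<in> carrier R" if "e \<in> ?E" for e
    using V1_closed[OF word_less[OF w i] X that] .
  have inner: "(\<Oplus>e\<in>?E. V1 (w i, X) e \<otimes> z l (?f e)) \<in> carrier R" if "l \<in> \<Lambda>" for l
    by (rule finsum_closed) (use vc zc[OF that] in blast)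
  have "(\<Oplus>l\<in>\<Lambda>. encode i l (z l) (w, X)) = (\<Oplus>l\<in>\<Lambda>. \<Oplus>e\<in>?E. V1 (w i, X) e \<otimes> z l (?f e))"
    using inner encode_unwanted[OF l(1) X l(2)] by (intro finsum_cong') auto
  also have "\<dots> = (\<Oplus>e\<in>?E. \<Oplus>l\<in>\<Lambda>. V1 (w i, X) e \<otimes> z l (?f e))"
    by (rule finsum_swap[OF fin]) (use vc zc in \<open>blast | simp\<close>)+
  also have "\<dots> = (\<Oplus>e\<in>?E. V1 (w i, X) e \<otimes> (\<Oplus>l\<in>\<Lambda>. z l (?f e)))"
  proof (rule finsum_cong'[OF refl])
    have "(\<Oplus>l\<in>\<Lambda>. z l (?f e)) \<in> carrier R" if "e \<in> ?E" for e
      by (rule finsum_closed) (use zc that in blast)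
    thus "(\<lambda>e. V1 (w i, X) e \<otimes> (\<Oplus>l\<in>\<Lambda>. z l (?f e))) \<in> ?E \<rightarrow> carrier R"
      using vc by blast
    show "(\<Oplus>l\<in>\<Lambda>. V1 (w i, X) e \<otimes> z l (?f e)) = V1 (w i, X) e \<otimes> (\<Oplus>l\<in>\<Lambda>. z l (?f e))"
      if "e \<in> ?E" for e
      by (rule finsum_rdistr[OF fin vc[OF that], symmetric]) (use zc that in blast)
  qed
  finally show ?thesis .
qed

text \<open>Treats one column of the files at a time. Of the unwanted files only the sums over an
  active set are recovered, never the files themselves: that is enough to cancel the
  interference.\<close>

lemma decoding:
  assumes i: "i < M" and J: "J \<subseteq> {..<N}" "card J = N - S"
    and z: "\<And>l. l < M \<Longrightarrow> z l \<in> vecs R (coords l)" and z': "\<And>l. l < M \<Longrightarrow> z' l \<in> vecs R (coords l)"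
    and eq: "\<And>w X. w \<in> words \<Longrightarrow> active w \<noteq> {} \<Longrightarrow> X \<in> Ks \<Longrightarrow> X \<subseteq> J \<Longrightarrow>
      (\<Oplus>l\<in>active w. encode i l (z l) (w, X)) = (\<Oplus>l\<in>active w. encode i l (z' l) (w, X))"
  shows "z i = z' i"
proof -
  let ?E = "{..<\<alpha>} \<times> {..<D}" and ?KJ = "{X\<in>Ks. X \<subseteq> J}"
  have "?KJ = {X. X \<subseteq> J \<and> card X = K}" using J by (auto simp: Ks)
  hence cKJ: "card ?KJ = D"
    using n_subsets[of J K] J by (simp add: D finite_subset)
  have am: "l < M" if "l \<in> active w" for l w using that by (simp add: active_def)
  have enc: "encode i l (z l) (w, X) \<in> carrier R" "encode i l (z' l) (w, X) \<in> carrier R"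
    if "w \<in> words" "X \<in> Ks" "l \<in> active w" for l w X
    using that vecs_mem[OF lin_map_vecs[OF encode_lin[OF i] z[OF am[OF that(3)]]], of "(w, X)"]
      vecs_mem[OF lin_map_vecs[OF encode_lin[OF i] z'[OF am[OF that(3)]]], of "(w, X)"]
      groups_active by auto
  \<comment> \<open>Letters below \<alpha> do not affect activity, so the \<alpha> groups of a
    bundle that omit file \<open>i\<close> sum over the same files and yield symbols of one
    codeword.\<close>
  have upd: "active (w(i := a)) = active w" if "w i < \<alpha>" "a < \<alpha>" for w a
    using that by (auto simp: active_def)
  have clear: "(\<Oplus>l\<in>active w. z l (w(i := fst e), snd e)) = (\<Oplus>l\<in>active w. z' l (w(i := fst e), snd e))"
    if w: "w \<in> words" "active w \<noteq> {}" "w i < \<alpha>" and e: "e \<in> ?E" for w e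
  proof (rule mds_matrixD[OF V1, where Q = "{..<\<alpha>} \<times> ?KJ"
        and t = "\<lambda>e. \<Oplus>l\<in>active w. z l (w(i := fst e), snd e)"
        and t' = "\<lambda>e. \<Oplus>l\<in>active w. z' l (w(i := fst e), snd e)", OF _ _ _ _ _ e])
    have ni: "active w \<subseteq> active w - {i}" using w by (auto simp: active_def)
    show "{..<\<alpha>} \<times> ?KJ \<subseteq> {..<D} \<times> Ks" using \<alpha>D by auto
    show "card ({..<\<alpha>} \<times> ?KJ) = card ?E" using cKJ by (simp add: card_cartesian_product)
    have r: "(w(i := fst e), snd e) \<in> coords l" if "e \<in> ?E" "l \<in> active w" for e l
      using row_upd[OF groups_active[OF w(1) that(2)] _ i that(1)] that ni by auto
    show "(\<Oplus>l\<in>active w. z l (w(i := fst e), snd e)) \<in> carrier R" if "e \<in> ?E" for e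
      by (rule finsum_closed, rule funcsetI, rule vecs_mem[OF z[OF am] r[OF that]])
    show "(\<Oplus>l\<in>active w. z' l (w(i := fst e), snd e)) \<in> carrier R" if "e \<in> ?E" for e
      by (rule finsum_closed, rule funcsetI, rule vecs_mem[OF z'[OF am] r[OF that]])
    fix p assume "p \<in> {..<\<alpha>} \<times> ?KJ"
    then obtain j X where p: "p = (j, X)" "j < \<alpha>" "X \<in> Ks" "X \<subseteq> J" by auto
    let ?w = "w(i := j)"
    have w': "?w \<in> words" using w p i \<alpha>D by (intro words_upd) auto
    have a: "active ?w = active w" using upd w p by blast
    have ni': "active w \<subseteq> active ?w - {i}" using ni a by auto
    have "(\<Oplus>l\<in>active w. encode i l (z l) (?w, X)) = (\<Oplus>l\<in>active w. encode i l (z' l) (?w, X))"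
      using eq[OF w' _ p(3,4)] w(2) unfolding a by blast
    moreover have "(\<Oplus>l\<in>active w. encode i l (z l) (?w, X)) =
        (\<Oplus>e\<in>?E. V1 (?w i, X) e \<otimes> (\<Oplus>l\<in>active w. z l (?w(i := fst e), snd e)))"
      by (rule interference[OF i w' p(3) ni']) (rule z, erule am)
    moreover have "(\<Oplus>l\<in>active w. encode i l (z' l) (?w, X)) =
        (\<Oplus>e\<in>?E. V1 (?w i, X) e \<otimes> (\<Oplus>l\<in>active w. z' l (?w(i := fst e), snd e)))"
      by (rule interference[OF i w' p(3) ni']) (rule z', erule am)
    ultimately show "(\<Oplus>e\<in>?E. V1 p e \<otimes> (\<Oplus>l\<in>active w. z l (w(i := fst e), snd e))) =
        (\<Oplus>e\<in>?E. V1 p e \<otimes> (\<Oplus>l\<in>active w. z' l (w(i := fst e), snd e)))"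
      by (simp add: p(1))
  qed
  show ?thesis
  proof (rule vecs_eqI[OF z[OF i] z'[OF i]])
    fix p assume "p \<in> coords i"
    then obtain w d where p: "p = (w, d)" "w \<in> groups i" "d < D" by (auto simp: coords_def)
    have w: "w \<in> words" "i \<in> active w" using p i by (auto simp: groups_def active_def)
    let ?\<Lambda> = "active w - {i}"
    \<comment> \<open>The group with letter 0 at \<open>i\<close> has active set
      \<open>?\<Lambda>\<close>. If that set is empty, the group is not queried, but then there is
      no interference either.\<close>
    have t: "(\<Oplus>l\<in>?\<Lambda>. z l (w(i := fst e), snd e)) = (\<Oplus>l\<in>?\<Lambda>. z' l (w(i := fst e), snd e))"
      if e: "e \<in> ?E" for e
    proof (cases "?\<Lambda> = {}")
      case False
      let ?w0 = "w(i := 0)"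
      have a: "active ?w0 = ?\<Lambda>" using \<alpha>_pos by (auto simp: active_def)
      have "?w0 \<in> words" using w i \<alpha>D by (intro words_upd) auto
      from clear[OF this _ _ e] False show ?thesis using \<alpha>_pos unfolding a by simp
    qed (simp only: finsum_empty)
    have int: "(\<Oplus>l\<in>?\<Lambda>. encode i l (z l) (w, X)) = (\<Oplus>l\<in>?\<Lambda>. encode i l (z' l) (w, X))" if X: "X \<in> Ks" for X
    proof -
      have zs: "\<And>l. l \<in> ?\<Lambda> \<Longrightarrow> z l \<in> vecs R (coords l)" "\<And>l. l \<in> ?\<Lambda> \<Longrightarrow> z' l \<in> vecs R (coords l)"
        using z z' am by blast+
      have c: "(\<Oplus>l\<in>?\<Lambda>. z' l (w(i := fst e), snd e)) \<in> carrier R" if "e \<in> ?E" for e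
      proof (rule finsum_closed, rule funcsetI)
        fix l assume l: "l \<in> ?\<Lambda>"
        show "z' l (w(i := fst e), snd e) \<in> carrier R"
          by (rule vecs_mem[OF zs(2)[OF l] row_upd[OF groups_active[OF w(1)] _ i that]]) (use l in auto)
      qed
      have "(\<Oplus>l\<in>?\<Lambda>. encode i l (z l) (w, X)) =
          (\<Oplus>e\<in>?E. V1 (w i, X) e \<otimes> (\<Oplus>l\<in>?\<Lambda>. z l (w(i := fst e), snd e)))"
        by (rule interference[OF i w(1) X subset_refl]) (rule zs)
      also have "\<dots> = (\<Oplus>e\<in>?E. V1 (w i, X) e \<otimes> (\<Oplus>l\<in>?\<Lambda>. z' l (w(i := fst e), snd e)))"
      proof (rule finsum_cong'[OF refl])
        show "(\<lambda>e. V1 (w i, X) e \<otimes> (\<Oplus>l\<in>?\<Lambda>. z' l (w(i := fst e), snd e))) \<in> ?E \<rightarrow> carrier R"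
          using c V1_closed[OF word_less[OF w(1) i] X] by blast
      qed (simp only: t)
      also have "\<dots> = (\<Oplus>l\<in>?\<Lambda>. encode i l (z' l) (w, X))"
        by (rule interference[OF i w(1) X subset_refl, symmetric]) (rule zs)
      finally show ?thesis .
    qed
    \<comment> \<open>With the interference cancelled, the \<open>D\<close> surviving symbols of the
      group form enough of a \<open>V2\<close> codeword.\<close>
    have "z i (w, d) = z' i (w, d)"
    proof (rule mds_matrixD[OF V2, where Q = ?KJ and t = "\<lambda>d. z i (w, d)" and t' = "\<lambda>d. z' i (w, d)"])
      show "card ?KJ = card {..<D}" using cKJ by simp
      show "z i (w, d) \<in> carrier R" "z' i (w, d) \<in> carrier R" if "d \<in> {..<D}" for d
        using that p vecs_mem[OF z[OF i] row_same] vecs_mem[OF z'[OF i] row_same] by auto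
      show "d \<in> {..<D}" using p by simp
      fix X assume "X \<in> ?KJ"
      hence X: "X \<in> Ks" "X \<subseteq> J" by auto
      have ins: "active w = insert i ?\<Lambda>" using w by auto
      have "(\<Oplus>l\<in>insert i ?\<Lambda>. encode i l (z l) (w, X)) = (\<Oplus>l\<in>insert i ?\<Lambda>. encode i l (z' l) (w, X))"
        using eq[OF w(1) _ X] w(2) ins by auto
      moreover have "(\<Oplus>l\<in>insert i ?\<Lambda>. encode i l (z l) (w, X)) =
          encode i i (z i) (w, X) \<oplus> (\<Oplus>l\<in>?\<Lambda>. encode i l (z l) (w, X))"
        using enc[OF w(1) X(1)] w(2) active_finite by (intro finsum_insert) auto
      moreover have "(\<Oplus>l\<in>insert i ?\<Lambda>. encode i l (z' l) (w, X)) =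
          encode i i (z' i) (w, X) \<oplus> (\<Oplus>l\<in>?\<Lambda>. encode i l (z' l) (w, X))"
        using enc[OF w(1) X(1)] w(2) active_finite by (intro finsum_insert) auto
      moreover have "(\<Oplus>l\<in>?\<Lambda>. encode i l (z' l) (w, X)) \<in> carrier R"
        using enc[OF w(1) X(1)] by (intro finsum_closed) auto
      ultimately have "encode i i (z i) (w, X) = encode i i (z' i) (w, X)"
        using enc[OF w(1) X(1) w(2)] int[OF X(1)] by simp
      thus "(\<Oplus>d\<in>{..<D}. V2 X d \<otimes> z i (w, d)) = (\<Oplus>d\<in>{..<D}. V2 X d \<otimes> z' i (w, d))"
        unfolding encode_wanted[OF p(2) X(1)] .
    qed auto
    thus "z i p = z' i p" by (simp add: p(1))
  qed
qed

lemma encode_key_closed: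
  assumes "i < M" "\<sigma> \<in> keys" "w \<in> words" "X \<in> Ks" "l \<in> active w" "v \<in> vecs R {..<L}"
  shows "encode i l (\<sigma> l v) (w, X) \<in> carrier R"
proof -
  have l: "l < M" using assms by (simp add: active_def)
  show ?thesis
    using groups_active[OF assms(3,5)] assms(4)
    by (intro vecs_mem[OF lin_map_vecs[OF encode_lin[OF assms(1)]
          lin_map_vecs[OF keys_mem(2)[OF assms(2) l] assms(6)]]]) simp
qed

text \<open>Keys and encoding are linear, so they move inside the storage code: for a fixed slot the
  replies of different servers are symbols, under \<open>G\<close>, of the vector of K column
  sums.\<close>

lemma reply_expand:
  assumes i: "i < M" and \<sigma>: "\<sigma> \<in> keys" and W: "W \<in> files" and s: "(w, X) \<in> slots n"
  shows "reply i \<sigma> n (stored R M L K G W n) (w, X) =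
    (\<Oplus>k\<in>{..<K}. G k n \<otimes> (\<Oplus>l\<in>active w. encode i l (\<sigma> l (file_col W l k)) (w, X)))"
proof -
  note s' = slots_mem[OF s]
  have Gc: "G k n \<in> carrier R" if "k < K" for k using G_closed[OF that s'(5)] .
  have fc: "file_col W l k \<in> vecs R {..<L}" if "l \<in> active w" "k < K" for l k
    using file_col_vecs[OF W _ that(2)] that(1) by (simp add: active_def)
  have ec: "encode i l (\<sigma> l (file_col W l k)) (w, X) \<in> carrier R" if "l \<in> active w" "k < K" for l k
    by (rule encode_key_closed[OF i \<sigma> s'(1,3) that(1) fc[OF that]])
  have "encode i l (\<sigma> l (col_of (stored R M L K G W n) l)) (w, X) =
      (\<Oplus>k\<in>{..<K}. G k n \<otimes> encode i l (\<sigma> l (file_col W l k)) (w, X))" if l: "l \<in> active w" for l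
  proof -
    have lM: "l < M" using l by (simp add: active_def)
    let ?c = "compose (vecs R {..<L}) (encode i l) (\<sigma> l)"
    have lin: "lin_map R {..<L} (groups l \<times> Ks) ?c"
      by (rule lin_map_compose[OF keys_mem(2)[OF \<sigma> lM] encode_lin[OF i]])
    have "?c (col_of (stored R M L K G W n) l) (w, X) = (\<Oplus>k\<in>{..<K}. G k n \<otimes> ?c (file_col W l k) (w, X))"
      unfolding col_stored[OF W lM s'(5)]
      by (rule lin_map_sum[OF lin]) (use groups_active[OF s'(1) l] s'(3) fc[OF l] Gc in auto)
    also have "\<dots> = (\<Oplus>k\<in>{..<K}. G k n \<otimes> encode i l (\<sigma> l (file_col W l k)) (w, X))"
      using fc[OF l] ec[OF l] Gc by (intro finsum_cong') (auto simp: compose_def)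
    finally show ?thesis
      using col_stored_vecs[OF W lM s'(5)] by (simp add: compose_def)
  qed
  hence "reply i \<sigma> n (stored R M L K G W n) (w, X) =
      (\<Oplus>l\<in>active w. \<Oplus>k\<in>{..<K}. G k n \<otimes> encode i l (\<sigma> l (file_col W l k)) (w, X))"
    using s ec Gc by (simp only: reply_def restrict_apply' prod.case, intro finsum_cong')
      (auto intro!: finsum_closed)
  also have "\<dots> = (\<Oplus>k\<in>{..<K}. \<Oplus>l\<in>active w. G k n \<otimes> encode i l (\<sigma> l (file_col W l k)) (w, X))"
    using ec Gc by (intro finsum_swap active_finite) auto
  also have "\<dots> = (\<Oplus>k\<in>{..<K}. G k n \<otimes> (\<Oplus>l\<in>active w. encode i l (\<sigma> l (file_col W l k)) (w, X)))"
  proof (rule finsum_cong'[OF refl])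
    fix k assume k: "k \<in> {..<K}"
    show "(\<Oplus>l\<in>active w. G k n \<otimes> encode i l (\<sigma> l (file_col W l k)) (w, X)) =
        G k n \<otimes> (\<Oplus>l\<in>active w. encode i l (\<sigma> l (file_col W l k)) (w, X))"
      using ec Gc k by (intro finsum_rdistr[symmetric] active_finite) auto
  qed (use ec Gc in \<open>auto intro!: finsum_closed\<close>)
  finally show ?thesis .
qed

lemma columns_independent:
  assumes X: "X \<in> Ks" and c: "c \<in> X \<rightarrow> carrier R"
    and z: "\<And>k. k < K \<Longrightarrow> (\<Oplus>n\<in>X. c n \<otimes> G k n) = \<zero>" and n: "n \<in> X"
  shows "c n = \<zero>"
proof -
  have "X \<subseteq> {..<N}" "card X = K" using X unfolding Ks by auto
  thus ?thesis using G c z n unfolding mds_generator_def by blast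
qed

text \<open>The K servers of a surviving K-set hold K symbols of the storage codeword of the column
  sums, which \<open>square_interpolation\<close> inverts; \<open>decoding\<close> then applies to
  each column.\<close>

lemma correctness:
  assumes i: "i < M" and J: "J \<subseteq> {..<N}" "card J = N - S" and \<sigma>: "\<sigma> \<in> keys"
    and W: "W \<in> files" and W': "W' \<in> files"
    and eq: "\<And>n. n \<in> J \<Longrightarrow> reply i \<sigma> n (stored R M L K G W n) = reply i \<sigma> n (stored R M L K G W' n)"
  shows "W i = W' i"
proof -
  define h where "h V k w X = (\<Oplus>l\<in>active w. encode i l (\<sigma> l (file_col V l k)) (w, X))" for V k w X
  have col: "file_col W i k = file_col W' i k" if k: "k < K" for k
  proof -
    have fc: "file_col V l k \<in> vecs R {..<L}" if "V \<in> files" "l < M" for V l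
      using file_col_vecs[OF that k] .
    have "h W k w X = h W' k w X" if w: "w \<in> words" "active w \<noteq> {}" and X: "X \<in> Ks" "X \<subseteq> J" for w X
    proof -
      have X': "X \<subseteq> {..<N}" "card X = K" using X unfolding Ks by auto
      have fX: "finite X" using X'(1) finite_subset by blast
      have hc: "h V k w X \<in> carrier R" if "V \<in> files" "k < K" for V k
        unfolding h_def
      proof (rule finsum_closed, rule funcsetI)
        fix l assume l: "l \<in> active w"
        hence "l < M" by (simp add: active_def)
        thus "encode i l (\<sigma> l (file_col V l k)) (w, X) \<in> carrier R"
          by (intro encode_key_closed[OF i \<sigma> w(1) X(1) l] file_col_vecs[OF that(1) _ that(2)])
      qed
      have "\<exists>c\<in>X \<rightarrow> carrier R. \<forall>h\<in>{..<K} \<rightarrow> carrier R.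
          h k = (\<Oplus>n\<in>X. c n \<otimes> (\<Oplus>k\<in>{..<K}. G k n \<otimes> h k))"
      proof (rule square_interpolation[where G = G, OF finR fX X'(2)])
        show "G k n \<in> carrier R" if "k < K" "n \<in> X" for k n
          using G_closed[OF that(1)] that(2) X'(1) by blast
      qed (rule columns_independent[OF X(1)], assumption+, fact k)
      then obtain c where c: "c \<in> X \<rightarrow> carrier R"
        "\<And>h. h \<in> {..<K} \<rightarrow> carrier R \<Longrightarrow> h k = (\<Oplus>n\<in>X. c n \<otimes> (\<Oplus>k\<in>{..<K}. G k n \<otimes> h k))"
        by blast
      have sl: "(w, X) \<in> slots n" if "n \<in> X" for n
        using w X that by (simp add: slots_def)
      have Gh: "(\<Oplus>k\<in>{..<K}. G k n \<otimes> h V k w X) \<in> carrier R" if "V \<in> files" "n \<in> X" for V n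
        using that X' hc[OF that(1)] G_closed by (intro finsum_closed) auto
      have "h W k w X = (\<Oplus>n\<in>X. c n \<otimes> (\<Oplus>k\<in>{..<K}. G k n \<otimes> h W k w X))"
        using hc[OF W] by (intro c(2)) auto
      also have "\<dots> = (\<Oplus>n\<in>X. c n \<otimes> (\<Oplus>k\<in>{..<K}. G k n \<otimes> h W' k w X))"
      proof (rule finsum_cong'[OF refl])
        show "(\<lambda>n. c n \<otimes> (\<Oplus>k\<in>{..<K}. G k n \<otimes> h W' k w X)) \<in> X \<rightarrow> carrier R"
          using c(1) Gh[OF W'] by blast
        fix n assume n: "n \<in> X"
        have "(\<Oplus>k\<in>{..<K}. G k n \<otimes> h W k w X) = (\<Oplus>k\<in>{..<K}. G k n \<otimes> h W' k w X)"
          using reply_expand[OF i \<sigma> W sl[OF n]] reply_expand[OF i \<sigma> W' sl[OF n]] eq[of n] n X(2)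
          unfolding h_def by auto
        thus "c n \<otimes> (\<Oplus>k\<in>{..<K}. G k n \<otimes> h W k w X) = c n \<otimes> (\<Oplus>k\<in>{..<K}. G k n \<otimes> h W' k w X)"
          by simp
      qed
      also have "\<dots> = h W' k w X"
        using hc[OF W'] by (intro c(2)[symmetric]) auto
      finally show ?thesis .
    qed
    hence "\<sigma> i (file_col W i k) = \<sigma> i (file_col W' i k)"
      unfolding h_def
      by (intro decoding[OF i J, where z = "\<lambda>l. \<sigma> l (file_col W l k)" and z' = "\<lambda>l. \<sigma> l (file_col W' l k)"]
          lin_map_vecs[OF keys_mem(2)[OF \<sigma>]] fc W W')
    thus ?thesis
      using keys_mem(3)[OF \<sigma> i] fc[OF W i] fc[OF W' i] by (meson bij_betw_def inj_onD)
  qed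
  have PiE: "V i \<in> ({..<L} \<times> {..<K} \<rightarrow>\<^sub>E carrier R)" if "V \<in> files" for V
    using that i unfolding file_tuples_def by (auto dest: PiE_mem[where x = i])
  show ?thesis
  proof (rule PiE_ext[OF PiE[OF W] PiE[OF W']])
    fix p assume "p \<in> {..<L} \<times> {..<K}"
    then obtain r k where p: "p = (r, k)" "r < L" "k < K" by auto
    show "W i p = W' i p"
      using fun_cong[OF col[OF p(3)], of r] p by (simp add: file_col_def)
  qed
qed

section \<open>Uniform distribution of the answers\<close>

lemma ex_subset_card_containing:
  assumes "n < N" "1 \<le> t" "t \<le> N"
  shows "\<exists>A\<subseteq>{..<N}. n \<in> A \<and> card A = t"
proof -
  have "t - 1 \<le> card ({..<N} - {n})" using assms by simp
  then obtain B where B: "B \<subseteq> {..<N} - {n}" "card B = t - 1" "finite B"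
    by (rule obtain_subset_with_card_n)
  hence "card (insert n B) = t" using assms(2) by (subst card_insert_disjoint) auto
  thus ?thesis using B assms by (intro exI[of _ "insert n B"]) auto
qed

text \<open>A zero column would violate independence in any K-set containing it, with the unit
  vector at \<open>n\<close> as coefficients.\<close>

lemma column_nonzero:
  assumes n: "n < N"
  shows "\<exists>k<K. G k n \<noteq> \<zero>"
proof (rule ccontr)
  assume "\<not> ?thesis"
  hence z: "G k n = \<zero>" if "k < K" for k using that by blast
  obtain J where J: "J \<subseteq> {..<N}" "n \<in> J" "card J = K"
    using ex_subset_card_containing[OF n, of K] KT by auto
  let ?c = "\<lambda>m. if m = n then \<one> else \<zero>"
  have "(\<Oplus>m\<in>J. ?c m \<otimes> G k m) = \<zero>" if k: "k < K" for k
  proof -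
    have "(\<Oplus>m\<in>J. ?c m \<otimes> G k m) = (\<Oplus>m\<in>J. \<zero>)"
      using z[OF k] G_closed[OF k] J by (intro finsum_cong') auto
    thus ?thesis by simp
  qed
  moreover have "?c \<in> J \<rightarrow> carrier R" by auto
  moreover have "J \<in> Ks" using J unfolding Ks by simp
  ultimately have "?c n = \<zero>"
    using columns_independent[of J ?c n] J(2) by blast
  thus False by simp
qed

lemma reply_vecs:
  assumes "i < M" "\<sigma> \<in> keys" "W \<in> files"
  shows "reply i \<sigma> n (stored R M L K G W n) \<in> vecs R (slots n)"
  unfolding reply_def
proof (rule vecs_restrict, clarify, rule finsum_closed, rule funcsetI)
  fix w X l assume s: "(w, X) \<in> slots n" and l: "l \<in> active w"
  have "l < M" using l by (simp add: active_def)
  thus "encode i l (\<sigma> l (col_of (stored R M L K G W n) l)) (w, X) \<in> carrier R"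
    using slots_mem[OF s] by (intro encode_key_closed col_stored_vecs assms l) auto
qed

definition shift :: "(nat \<Rightarrow> 'c file_matrix) \<Rightarrow> (nat \<Rightarrow> 'c file_matrix) \<Rightarrow> nat \<Rightarrow> 'c file_matrix" where
  "shift V W = (\<lambda>l\<in>{..<M}. \<lambda>p\<in>{..<L} \<times> {..<K}. W l p \<oplus> V l p)"

lemma shift_files: "V \<in> files \<Longrightarrow> W \<in> files \<Longrightarrow> shift V W \<in> files"
  using file_closed[of V] file_closed[of W] unfolding file_tuples_def[of _ _ _ K] shift_def
  by (intro restrict_PiE_iff[THEN iffD2] ballI) auto

lemma reply_shift:
  assumes i: "i < M" and \<sigma>: "\<sigma> \<in> keys" and V: "V \<in> files" and W: "W \<in> files" and s: "(w, X) \<in> slots n"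
  shows "reply i \<sigma> n (stored R M L K G (shift V W) n) (w, X) =
    reply i \<sigma> n (stored R M L K G W n) (w, X) \<oplus> reply i \<sigma> n (stored R M L K G V n) (w, X)"
proof -
  note s' = slots_mem[OF s]
  have Gc: "G k n \<in> carrier R" if "k < K" for k using G_closed[OF that s'(5)] .
  let ?e = "\<lambda>V l k. encode i l (\<sigma> l (file_col V l k)) (w, X)"
  have fc: "file_col V l k \<in> vecs R {..<L}" if "V \<in> files" "l \<in> active w" "k < K" for V l k
    using file_col_vecs[OF that(1) _ that(3)] that(2) by (simp add: active_def)
  have ec: "?e V l k \<in> carrier R" if "V \<in> files" "l \<in> active w" "k < K" for V l k
    by (rule encode_key_closed[OF i \<sigma> s'(1,3) that(2) fc[OF that]])
  have sc: "(\<Oplus>l\<in>active w. ?e V l k) \<in> carrier R" if "V \<in> files" "k < K" for V k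
    using ec that by (intro finsum_closed) auto
  have add: "?e (shift V W) l k = ?e W l k \<oplus> ?e V l k" if l: "l \<in> active w" and k: "k < K" for l k
  proof -
    have lM: "l < M" using l by (simp add: active_def)
    let ?c = "compose (vecs R {..<L}) (encode i l) (\<sigma> l)"
    have lin: "lin_map R {..<L} (groups l \<times> Ks) ?c"
      by (rule lin_map_compose[OF keys_mem(2)[OF \<sigma> lM] encode_lin[OF i]])
    have "file_col (shift V W) l k = (\<lambda>r\<in>{..<L}. file_col W l k r \<oplus> file_col V l k r)"
      using lM k by (auto simp: file_col_def shift_def intro!: restrict_ext)
    moreover have "(w, X) \<in> groups l \<times> Ks" using groups_active[OF s'(1) l] s'(3) by simp
    ultimately have "?c (file_col (shift V W) l k) (w, X) =
        ?c (file_col W l k) (w, X) \<oplus> ?c (file_col V l k) (w, X)"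
      using lin_map_add[OF lin fc[OF W l k] fc[OF V l k]] by simp
    thus ?thesis
      using fc[OF W l k] fc[OF V l k] fc[OF shift_files[OF V W] l k] by (simp add: compose_def)
  qed
  have "reply i \<sigma> n (stored R M L K G (shift V W) n) (w, X) =
      (\<Oplus>k\<in>{..<K}. G k n \<otimes> (\<Oplus>l\<in>active w. ?e (shift V W) l k))"
    by (rule reply_expand[OF i \<sigma> shift_files[OF V W] s])
  also have "\<dots> = (\<Oplus>k\<in>{..<K}. G k n \<otimes> (\<Oplus>l\<in>active w. ?e W l k) \<oplus> G k n \<otimes> (\<Oplus>l\<in>active w. ?e V l k))"
  proof (rule finsum_cong'[OF refl])
    fix k assume "k \<in> {..<K}"
    hence k: "k < K" by simp
    have "(\<Oplus>l\<in>active w. ?e (shift V W) l k) = (\<Oplus>l\<in>active w. ?e W l k \<oplus> ?e V l k)"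
      using add[OF _ k] ec[OF W _ k] ec[OF V _ k] by (intro finsum_cong') auto
    also have "\<dots> = (\<Oplus>l\<in>active w. ?e W l k) \<oplus> (\<Oplus>l\<in>active w. ?e V l k)"
      using ec[OF W _ k] ec[OF V _ k] by (intro finsum_addf) auto
    finally show "G k n \<otimes> (\<Oplus>l\<in>active w. ?e (shift V W) l k) =
        G k n \<otimes> (\<Oplus>l\<in>active w. ?e W l k) \<oplus> G k n \<otimes> (\<Oplus>l\<in>active w. ?e V l k)"
      using r_distr[OF sc[OF W k] sc[OF V k] Gc[OF k]] by simp
  qed (use sc V W Gc in auto)
  also have "\<dots> = (\<Oplus>k\<in>{..<K}. G k n \<otimes> (\<Oplus>l\<in>active w. ?e W l k)) \<oplus>
      (\<Oplus>k\<in>{..<K}. G k n \<otimes> (\<Oplus>l\<in>active w. ?e V l k))"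
    using sc V W Gc by (intro finsum_addf) auto
  finally show ?thesis
    unfolding reply_expand[OF i \<sigma> V s] reply_expand[OF i \<sigma> W s] .
qed

text \<open>The symbols visible to one server are rows of a bijective completion and can be
  prescribed freely, file by file; one active file per group is enough to carry the value.\<close>

lemma reply_surj:
  assumes i: "i < M" and \<sigma>: "\<sigma> \<in> keys" and n: "n < N" and b: "b \<in> vecs R (slots n)"
  shows "\<exists>V\<in>files. reply i \<sigma> n (stored R M L K G V n) = b"
proof -
  \<comment> \<open>Placing \<open>n\<close> among T servers makes the completion built for privacy
    available again.\<close>
  obtain A where A: "A \<subseteq> {..<N}" "n \<in> A" "card A = T"
    using ex_subset_card_containing[OF n, of T] KT by auto
  obtain \<rho> where \<rho>: "inj_on \<rho> {..<D}" "\<rho> ` {..<D} \<subseteq> Ks" "\<rho> ` {..<\<alpha>} = {X\<in>Ks. X \<inter> A \<noteq> {}}"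
    using visible_positions[OF A(1,3)] by blast
  obtain k0 where k0: "k0 < K" "G k0 n \<noteq> \<zero>" using column_nonzero[OF n] by blast
  have g: "G k0 n \<in> carrier R" "inv (G k0 n) \<in> carrier R" "inv (G k0 n) \<otimes> G k0 n = \<one>"
    using G_closed[OF k0(1) n] k0(2) field_Units by (auto intro: Units_l_inv)
  \<comment> \<open>The least active file carries the whole symbol of group \<open>w\<close>; the
    other active files contribute zero.\<close>
  define f where "f w = Min (active w)" for w
  have f: "f w \<in> active w" if "active w \<noteq> {}" for w
    unfolding f_def using active_finite that by (rule Min_in)
  define u where "u l = (\<lambda>p\<in>coords l. if l = f (fst p) \<and> (fst p, \<rho> (snd p)) \<in> slots n \<and> snd p < \<alpha>
      then b (fst p, \<rho> (snd p)) else \<zero>)" for l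
  have u: "u l \<in> vecs R (coords l)" for l
    unfolding u_def by (rule vecs_restrict) (use vecs_mem[OF b] in auto)
  have "\<exists>v\<in>vecs R {..<L}. completion \<rho> i l (\<sigma> l v) = u l" if l: "l < M" for l
  proof -
    have "u l \<in> completion \<rho> i l ` vecs R (coords l)"
      using completion_bij(2)[OF i l \<rho>(1,2)] u by (simp only: bij_betw_def)
    then obtain z where z: "z \<in> vecs R (coords l)" "completion \<rho> i l z = u l" by auto
    have "z \<in> \<sigma> l ` vecs R {..<L}"
      using keys_mem(3)[OF \<sigma> l] z(1) by (simp only: bij_betw_def)
    thus ?thesis using z(2) by auto
  qed
  then obtain v where v: "\<And>l. l < M \<Longrightarrow> v l \<in> vecs R {..<L}"
    "\<And>l. l < M \<Longrightarrow> completion \<rho> i l (\<sigma> l (v l)) = u l"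
    by metis
  \<comment> \<open>Only column \<open>k0\<close> is used, scaled by the inverse of
    \<open>G k0 n\<close> so that server \<open>n\<close> stores exactly \<open>v l\<close>.\<close>
  define V where "V = (\<lambda>l\<in>{..<M}. \<lambda>p\<in>{..<L} \<times> {..<K}.
    if snd p = k0 then v l (fst p) \<otimes> inv (G k0 n) else \<zero>)"
  have vc: "v l r \<in> carrier R" if "l < M" "r < L" for l r
    using vecs_mem[OF v(1)[OF that(1)]] that(2) by simp
  have V: "V \<in> files"
    unfolding file_tuples_def V_def using vc g(2)
    by (intro restrict_PiE_iff[THEN iffD2] ballI) auto
  have col: "col_of (stored R M L K G V n) l = v l" if l: "l < M" for l
  proof (rule vecs_eqI[OF col_stored_vecs[OF V l n] v(1)[OF l]])
    fix r assume r: "r \<in> {..<L}"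
    have vr: "v l r \<in> carrier R" using vecs_mem[OF v(1)[OF l] r] .
    have "stored R M L K G V n (l, r) = (\<Oplus>k\<in>{..<K}. V l (r, k) \<otimes> G k n)"
      using l r by (simp add: stored_def)
    also have "\<dots> = (\<Oplus>k\<in>{..<K}. if k0 = k then v l r else \<zero>)"
    proof (rule finsum_cong'[OF refl])
      fix k assume k: "k \<in> {..<K}"
      have "v l r \<otimes> inv (G k0 n) \<otimes> G k0 n = v l r"
        using g vr by (simp add: m_assoc)
      thus "V l (r, k) \<otimes> G k n = (if k0 = k then v l r else \<zero>)"
        using l r k G_closed[of k n] n by (cases "k0 = k") (simp_all add: V_def)
    qed (use vr in auto)
    also have "\<dots> = v l r"
      using k0 vr by (intro finsum_singleton) auto
    finally show "col_of (stored R M L K G V n) l r = v l r"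
      using r by (simp add: col_of_def)
  qed
  have "reply i \<sigma> n (stored R M L K G V n) = b"
  proof (rule vecs_eqI[OF reply_vecs[OF i \<sigma> V] b])
    fix p assume p: "p \<in> slots n"
    obtain w X where wX: "p = (w, X)" by (cases p)
    have s: "(w, X) \<in> slots n" using p wX by simp
    note s' = slots_mem[OF s]
    have X: "X \<in> \<rho> ` {..<\<alpha>}" using s' A unfolding \<rho>(3) by auto
    then obtain d where d: "d < \<alpha>" "X = \<rho> d" by auto
    have bc: "b (w, X) \<in> carrier R" using vecs_mem[OF b s] .
    have "reply i \<sigma> n (stored R M L K G V n) (w, X) =
        (\<Oplus>l\<in>active w. encode i l (\<sigma> l (col_of (stored R M L K G V n) l)) (w, X))"
      using s by (simp add: reply_def)
    also have "\<dots> = (\<Oplus>l\<in>active w. if f w = l then b (w, X) else \<zero>)"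
    proof (rule finsum_cong'[OF refl])
      fix l assume l: "l \<in> active w"
      hence lM: "l < M" by (simp add: active_def)
      have c: "(w, d) \<in> coords l"
        using groups_active[OF s'(1) l] d \<alpha>D by (simp add: coords_def)
      have "encode i l (\<sigma> l (v l)) (w, X) = u l (w, d)"
        using encode_completion[OF groups_active[OF s'(1) l] d(1), of i "\<sigma> l (v l)" \<rho>] v(2)[OF lM] d
        by simp
      also have "\<dots> = (if f w = l then b (w, X) else \<zero>)"
        using c s d by (auto simp: u_def)
      finally show "encode i l (\<sigma> l (col_of (stored R M L K G V n) l)) (w, X) =
          (if f w = l then b (w, X) else \<zero>)"
        by (simp add: col[OF lM])
    qed (use bc in auto)
    also have "\<dots> = b (w, X)"
      using f[OF s'(2)] bc active_finite by (intro finsum_singleton) auto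
    finally show "reply i \<sigma> n (stored R M L K G V n) p = b p" by (simp add: wX)
  qed
  thus ?thesis using V by blast
qed

lemma files_finite: "finite files"
  unfolding file_tuples_def using finR by (intro finite_PiE) auto

text \<open>Replies are additive in the files, so translation by a preimage of a' - a embeds one
  fibre into the other.\<close>

lemma reply_fibres:
  assumes i: "i < M" and \<sigma>: "\<sigma> \<in> keys" and n: "n < N"
    and a: "a \<in> vecs R (slots n)" and a': "a' \<in> vecs R (slots n)"
  shows "card {W\<in>files. reply i \<sigma> n (stored R M L K G W n) = a} \<le>
    card {W\<in>files. reply i \<sigma> n (stored R M L K G W n) = a'}"
proof -
  let ?b = "\<lambda>p\<in>slots n. a' p \<ominus> a p"
  have "?b \<in> vecs R (slots n)"
    by (intro vecs_restrict minus_closed vecs_mem[OF a] vecs_mem[OF a'])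
  then obtain V where V: "V \<in> files" "reply i \<sigma> n (stored R M L K G V n) = ?b"
    using reply_surj[OF i \<sigma> n] by blast
  show ?thesis
  proof (rule card_inj_on_le)
    show "inj_on (shift V) {W\<in>files. reply i \<sigma> n (stored R M L K G W n) = a}"
    proof (rule inj_onI)
      fix W W' assume "W \<in> {W\<in>files. reply i \<sigma> n (stored R M L K G W n) = a}"
        "W' \<in> {W\<in>files. reply i \<sigma> n (stored R M L K G W n) = a}" and eq: "shift V W = shift V W'"
      hence W: "W \<in> files" and W': "W' \<in> files" by auto
      show "W = W'"
      proof (rule PiE_ext[OF W[unfolded file_tuples_def] W'[unfolded file_tuples_def]])
        fix l assume l: "l \<in> {..<M}"
        have PiE: "W l \<in> ({..<L} \<times> {..<K} \<rightarrow>\<^sub>E carrier R)" if "W \<in> files" for W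
          by (rule PiE_mem[OF that[unfolded file_tuples_def] l])
        show "W l = W' l"
        proof (rule PiE_ext[OF PiE[OF W] PiE[OF W']])
          fix p assume p: "p \<in> {..<L} \<times> {..<K}"
          have "shift V W l p = shift V W' l p" using eq by simp
          hence "W l p \<oplus> V l p = W' l p \<oplus> V l p" using l p by (simp add: shift_def)
          thus "W l p = W' l p"
            using PiE_mem[OF PiE[OF W] p] PiE_mem[OF PiE[OF W'] p] PiE_mem[OF PiE[OF V(1)] p]
            by (simp add: add.right_cancel)
        qed
      qed
    qed
    show "shift V ` {W\<in>files. reply i \<sigma> n (stored R M L K G W n) = a} \<subseteq>
        {W\<in>files. reply i \<sigma> n (stored R M L K G W n) = a'}"
    proof (rule image_subsetI)
      fix W assume "W \<in> {W\<in>files. reply i \<sigma> n (stored R M L K G W n) = a}"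
      hence W: "W \<in> files" and Wa: "reply i \<sigma> n (stored R M L K G W n) = a" by auto
      have "reply i \<sigma> n (stored R M L K G (shift V W) n) = a'"
      proof (rule vecs_eqI[OF reply_vecs[OF i \<sigma> shift_files[OF V(1) W]] a'])
        fix p assume p: "p \<in> slots n"
        obtain w X where wX: "p = (w, X)" by (cases p)
        have "reply i \<sigma> n (stored R M L K G (shift V W) n) p = a p \<oplus> (a' p \<ominus> a p)"
          using reply_shift[OF i \<sigma> V(1) W, of w X n] p unfolding wX Wa V(2) by simp
        also have "\<dots> = a' p"
          using vecs_mem[OF a p] vecs_mem[OF a' p] by algebra
        finally show "reply i \<sigma> n (stored R M L K G (shift V W) n) p = a' p" .
      qed
      thus "shift V W \<in> {W\<in>files. reply i \<sigma> n (stored R M L K G W n) = a'}"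
        using shift_files[OF V(1) W] by simp
    qed
    show "finite {W\<in>files. reply i \<sigma> n (stored R M L K G W n) = a'}"
      using files_finite by simp
  qed
qed

lemma slots_finite: "finite (slots n)"
  using words_finite Ks_finite by (simp add: slots_def)

text \<open>The words without active file are those with all letters below \<alpha>; Pascal's rule
  counts the K-sets through \<open>n\<close>.\<close>

lemma card_slots:
  assumes n: "n < N"
  shows "card (slots n) = (D ^ M - \<alpha> ^ M) * ((N - 1) choose (K - 1))"
proof -
  let ?P = "{..<M} \<rightarrow>\<^sub>E {..<\<alpha>}"
  have sub: "?P \<subseteq> words" using \<alpha>D unfolding words_def by (intro PiE_mono) auto
  have "{w\<in>words. active w \<noteq> {}} = words - ?P"
  proof -
    have "active w = {} \<longleftrightarrow> w \<in> ?P" if "w \<in> words" for w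
      using that by (auto simp: active_def words_def PiE_iff not_le)
    thus ?thesis by blast
  qed
  hence 1: "card {w\<in>words. active w \<noteq> {}} = D ^ M - \<alpha> ^ M"
    using sub words_finite by (simp add: card_Diff_subset finite_subset words_def card_PiE)
  have "{X\<in>Ks. n \<in> X} = Ks - {X. X \<subseteq> {..<N} - {n} \<and> card X = K}" by (auto simp: Ks)
  moreover have "{X. X \<subseteq> {..<N} - {n} \<and> card X = K} \<subseteq> Ks" by (auto simp: Ks)
  moreover have "card {X. X \<subseteq> {..<N} - {n} \<and> card X = K} = (N - 1) choose K"
    using n n_subsets[of "{..<N} - {n}" K] by simp
  ultimately have "card {X\<in>Ks. n \<in> X} = (N choose K) - ((N - 1) choose K)"
    using Ks_finite Ks_card by (simp add: card_Diff_subset finite_subset)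
  also have "\<dots> = (N - 1) choose (K - 1)"
    using KT n by (cases N; cases K) auto
  finally show ?thesis
    using 1 by (simp add: slots_def card_cartesian_product)
qed

end

text \<open>The absorption identity \<open>K * D = (N - S) * ((N - S - 1) choose (K - 1))\<close> and a geometric sum
  turn the ratio of file size to download into the stated form.\<close>

lemma rate_identity:
  fixes \<alpha> D N K M S :: nat
  assumes D: "D = (N - S) choose K" and \<alpha>: "\<alpha> < D" and K: "1 \<le> K" "1 \<le> M"
  shows "real ((D - \<alpha>) * D ^ M * K) / real ((N - S) * ((D ^ M - \<alpha> ^ M) * ((N - 1) choose (K - 1)))) =
    real ((N - S - 1) choose (K - 1)) / real ((N - 1) choose (K - 1)) *
    inverse (\<Sum>j<M. (real \<alpha> / real D) ^ j)"
proof -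
  define a d where "a = real \<alpha>" and "d = real D"
  have ad: "0 \<le> a" "a < d" using \<alpha> by (simp_all add: a_def d_def)
  have pw: "a ^ M < d ^ M" using ad K by (intro power_strict_mono) auto
  have le: "\<alpha> ^ M \<le> D ^ M" using \<alpha> by (intro power_mono) auto
  \<comment> \<open>Without responding servers \<open>D\<close> would be zero, against
    \<open>\<alpha> < D\<close>.\<close>
  have NS: "0 < N - S" using D \<alpha> K by (cases "N - S = 0") (auto simp: binomial_eq_0)
  have "K * ((N - S) choose K) = (N - S) * ((N - S - 1) choose (K - 1))"
    using K by (intro times_binomial_minus1_eq) auto
  hence "real K * d = real (N - S) * real ((N - S - 1) choose (K - 1))"
    unfolding d_def D by (metis of_nat_mult)
  hence absorb: "real ((N - S - 1) choose (K - 1)) = real K * d / real (N - S)"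
    using NS by (simp add: field_simps)
  have "(\<Sum>j<M. (a / d) ^ j) = ((a / d) ^ M - 1) / (a / d - 1)"
    using ad by (intro geometric_sum) auto
  also have "\<dots> = (d ^ M - a ^ M) * d / (d ^ M * (d - a))"
    using ad by (simp add: power_divide field_simps)
  finally have inv: "inverse (\<Sum>j<M. (a / d) ^ j) = d ^ M * (d - a) / ((d ^ M - a ^ M) * d)"
    by simp
  have num: "real ((D - \<alpha>) * D ^ M * K) = (d - a) * d ^ M * real K"
    using \<alpha> by (simp add: a_def d_def of_nat_diff)
  have den: "real ((N - S) * ((D ^ M - \<alpha> ^ M) * ((N - 1) choose (K - 1)))) =
      real (N - S) * ((d ^ M - a ^ M) * real ((N - 1) choose (K - 1)))"
    using le by (simp add: a_def d_def of_nat_diff)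
  show ?thesis
    unfolding num den absorb a_def[symmetric] d_def[symmetric] inv using ad by (simp add: mult_ac)
qed

theorem theorem2:
  fixes N K T M S :: nat
  assumes "N \<ge> 1" and "K \<ge> 1" and "T \<ge> 1" and "M \<ge> 1"
    and "T + K \<le> N"
    and "(N choose K) - ((N - T) choose K) < ((N - S) choose K)"
  shows "\<exists>q0. \<forall>q\<ge>q0. primepow q \<longrightarrow>
    (\<forall>(R :: nat ring) G. field R \<and> finite (carrier R) \<and> card (carrier R) = q \<and>
        mds_generator R K N G \<longrightarrow>
      (\<exists>L>0. \<exists>Sch :: (nat, nat list, nat list, nat list, nat list) scheme.
         pir_scheme R N K T S M L G Sch \<and>
         (\<forall>i<M. \<forall>J \<subseteq> {..<N}. card J = N - S \<longrightarrow>
            pir_rate R M L K G Sch i J =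
              real ((N - S - 1) choose (K - 1)) / real ((N - 1) choose (K - 1)) *
              inverse (\<Sum>j<M.
                ((real (N choose K) - real ((N - T) choose K)) / real ((N - S) choose K)) ^ j))))"
proof -
  define \<alpha> D where "\<alpha> = (N choose K) - ((N - T) choose K)" and "D = (N - S) choose K"
  define Ks where "Ks = {X. X \<subseteq> {..<N} \<and> card X = K}"
  have \<alpha>D: "\<alpha> < D" using assms by (simp add: \<alpha>_def D_def)
  have Ks: "finite Ks" "card Ks = N choose K"
    unfolding Ks_def using n_subsets[of "{..<N}" K] by (auto intro: finite_subset[of _ "Pow {..<N}"])
  \<comment> \<open>The truncated difference is exact, as the binomial grows with its upper
    argument.\<close>
  have "real \<alpha> = real (N choose K) - real ((N - T) choose K)"
    unfolding \<alpha>_def by (intro of_nat_diff binomial_right_mono) simp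
  note rate = rate_identity[OF D_def \<alpha>D assms(2,4), unfolded this D_def[symmetric]]
  show ?thesis
  \<comment> \<open>The threshold is the length of \<open>V1\<close>; since \<open>D\<close> is
    positive it also bounds the length of \<open>V2\<close>.\<close>
  proof (rule exI[of _ "D * (N choose K)"], intro allI impI)
    fix q and R :: "nat ring" and G
    assume q: "D * (N choose K) \<le> q"
      and R: "field R \<and> finite (carrier R) \<and> card (carrier R) = q \<and> mds_generator R K N G"
    interpret field R using R by simp
    have fin: "finite (carrier R)" using R by simp
    have Kc: "(N choose K) \<le> D * (N choose K)" using \<alpha>D by simp
    obtain V1 where V1: "mds_matrix R ({..<D} \<times> Ks) ({..<\<alpha>} \<times> {..<D}) V1"
      using mds_matrix_exists[OF fin, of "{..<D} \<times> Ks" "{..<\<alpha>} \<times> {..<D}"] Ks q R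
      by (auto simp: card_cartesian_product)
    obtain V2 where V2: "mds_matrix R Ks {..<D} V2"
      using mds_matrix_exists[OF fin, of Ks "{..<D}"] Ks q Kc R by auto
    interpret group_scheme R N K T M S \<alpha> D G V1 V2 Ks
      by unfold_locales (use R V1 V2 assms \<alpha>D in \<open>auto simp: \<alpha>_def D_def Ks_def\<close>)
    \<comment> \<open>Entropies are logarithms to base q, which must exceed 1.\<close>
    have "card {\<zero>\<^bsub>R\<^esub>, \<one>\<^bsub>R\<^esub>} \<le> card (carrier R)"
      using fin by (intro card_mono) auto
    hence q2: "2 \<le> card (carrier R)" by simp
    have "\<exists>Sch :: (nat, nat list, nat list, nat list, nat list) scheme.
      pir_scheme R N K T S M L G Sch \<and> (\<forall>i<M. \<forall>J \<subseteq> {..<N}. card J = N - S \<longrightarrow>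
       pir_rate R M L K G Sch i J =
         real (L * K) / real ((N - S) * ((D ^ M - \<alpha> ^ M) * ((N - 1) choose (K - 1)))))"
    proof (rule scheme_of_answer_maps[OF keys_finite keys_nonempty fin q2, where ans = reply
          and Tgt = "\<lambda>n. vecs R (slots n)"])
      show "finite (vecs R (slots n))" for n
        by (rule finite_vecs[OF slots_finite fin])
      show "card (vecs R (slots n)) =
          card (carrier R) ^ ((D ^ M - \<alpha> ^ M) * ((N - 1) choose (K - 1)))" if "n < N" for n
        by (simp add: card_vecs[OF slots_finite] card_slots[OF that])
    qed (fact correctness privacy | rule reply_vecs reply_fibres, assumption+)+
    moreover have "0 < L" using \<alpha>D by (simp add: L_def)
    ultimately show "\<exists>L>0. \<exists>Sch :: (nat, nat list, nat list, nat list, nat list) scheme.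
         pir_scheme R N K T S M L G Sch \<and>
         (\<forall>i<M. \<forall>J \<subseteq> {..<N}. card J = N - S \<longrightarrow>
            pir_rate R M L K G Sch i J =
              real ((N - S - 1) choose (K - 1)) / real ((N - 1) choose (K - 1)) *
              inverse (\<Sum>j<M.
                ((real (N choose K) - real ((N - T) choose K)) / real ((N - S) choose K)) ^ j))"
      unfolding L_def rate D_def[symmetric] by blast
  qed
qed

end
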